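(* Let $u>0$, $c>0$, and let $\{\xi_\mu(x)\}_{x,\mu\in\mathbf{N}}$ be real jointly Gaussian random variables with zero mean and covariance $\mathbf{E}\{\xi_\mu(x)\xi_\nu(y)\}=u^2\delta_{xy}\delta_{\mu\nu}$. Let $H_{m,N}$ be the $N\times N$ random matrix with entries $$H_{m,N}(x,y)=\frac1N\sum_{\mu=1}^m \xi_\mu(x)\xi_\mu(y),\qquad x,y=1,\dots,N,$$ let $G_{m,N}(z)=(H_{m,N}-z)^{-1}$, and set $$R_{m,N}^{(\alpha)}(\lambda)=\frac1N\,\mathrm{Im}\,\mathrm{Tr}\,G_{m,N}(\lambda+\mathrm{i}N^{-\alpha}).$$ If $0<\alpha<1$ and $\lambda\in\Lambda_{c,u}=(u^2(1-\sqrt c)^2,\;u^2(1+\sqrt c)^2)$, then as $N,m\to\infty$ with $m/N\to c$, the random variable $R_{m,N}^{(\alpha)}(\lambda)$ converges with probability $1$ to the nonrandom limit $$\pi\varrho_c(\lambda)=\frac{1}{2\lambda u^2}\sqrt{4cu^4-[\lambda-u^2(1+c)]^2}.$$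
   Context: $\delta_{xy}$ denotes the Kronecker delta. $\mathrm{Tr}$ is the (unnormalized) trace, and $\mathrm{i}$ is the imaginary unit. The limit is taken along $m=m(N)$ with $m/N\to c$ as $N\to\infty$; all matrices are built from the same infinite array $\{\xi_\mu(x)\}$ on one probability space. *)

theory Defs
  imports
    "HOL-Probability.Probability"
    "Jordan_Normal_Form.Gauss_Jordan_Elimination"
begin

(* Point masses count as (degenerate) Gaussians, so that every linear combination of
   jointly Gaussian variables is Gaussian. *)
definition gaussian_rv :: "'a measure \<Rightarrow> ('a \<Rightarrow> real) \<Rightarrow> bool" where
  "gaussian_rv M X \<longleftrightarrow> X \<in> borel_measurable M \<and>
     (\<exists>a. (AE \<omega> in M. X \<omega> = a) \<or>
        (\<exists>\<sigma>>0. distributed M lborel X (\<lambda>t. ennreal (normal_density a \<sigma> t))))"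

(* A family is jointly Gaussian iff every finite linear combination is Gaussian. *)
definition jointly_gaussian :: "'a measure \<Rightarrow> 'i set \<Rightarrow> ('i \<Rightarrow> 'a \<Rightarrow> real) \<Rightarrow> bool" where
  "jointly_gaussian M I X \<longleftrightarrow>
     (\<forall>J \<subseteq> I. finite J \<longrightarrow> (\<forall>c :: 'i \<Rightarrow> real. gaussian_rv M (\<lambda>\<omega>. \<Sum>i\<in>J. c i * X i \<omega>)))"

definition mat_tr :: "'a :: comm_monoid_add mat \<Rightarrow> 'a" where
  "mat_tr A = (\<Sum>i<dim_row A. A $$ (i, i))"

(* The argument is one realization of the array; rows and columns of the matrix, hence
   also the array indices, start at 0. *)
definition H_mat :: "(nat \<Rightarrow> nat \<Rightarrow> real) \<Rightarrow> nat \<Rightarrow> nat \<Rightarrow> complex mat" where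
  "H_mat \<xi> m N =
     mat N N (\<lambda>(x, y). complex_of_real (1 / real N * (\<Sum>\<mu><m. \<xi> \<mu> x * \<xi> \<mu> y)))"

(* H is real symmetric, so the inverse exists for every non-real z. *)
definition G_mat :: "(nat \<Rightarrow> nat \<Rightarrow> real) \<Rightarrow> nat \<Rightarrow> nat \<Rightarrow> complex \<Rightarrow> complex mat" where
  "G_mat \<xi> m N z = the (mat_inverse (H_mat \<xi> m N - z \<cdot>\<^sub>m 1\<^sub>m N))"

definition R_stat :: "(nat \<Rightarrow> nat \<Rightarrow> real) \<Rightarrow> nat \<Rightarrow> nat \<Rightarrow> real \<Rightarrow> real \<Rightarrow> real" where
  "R_stat \<xi> m N \<alpha> l =
     1 / real N * Im (mat_tr (G_mat \<xi> m N (Complex l (real N powr (- \<alpha>)))))"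

definition \<Lambda>_set :: "real \<Rightarrow> real \<Rightarrow> real set" where
  "\<Lambda>_set c u = {u\<^sup>2 * (1 - sqrt c)\<^sup>2 <..< u\<^sup>2 * (1 + sqrt c)\<^sup>2}"

(* Marchenko-Pastur density, without its atom at 0; intended for l in \<Lambda>_set c u. *)
definition \<rho>_MP :: "real \<Rightarrow> real \<Rightarrow> real \<Rightarrow> real" where
  "\<rho>_MP u c l =
     1 / (2 * pi * l * u\<^sup>2) * sqrt (4 * c * u ^ 4 - (l - u\<^sup>2 * (1 + c))\<^sup>2)"

end

theory Submission
  imports Defs "Jordan_Normal_Form.Determinant" "HOL-Real_Asymp.Real_Asymp"
begin

text \<open>
  Let \<open>g = N\<^sup>-\<^sup>1 Tr G(z)\<close>, \<open>\<eta> = Im z\<close> and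
  \<open>P = 1 + (z + u\<^sup>2 (1 - m/N)) g + u\<^sup>2 z g\<^sup>2\<close>. Gaussian integration by parts shows that
  \<open>E \<bar>P\<bar>\<^bsup>2p\<^esup>\<close> consists only of error terms, which the Ward identity bounds by
  \<open>K E (\<epsilon> \<bar>g\<bar> \<bar>P\<bar>\<^bsup>2p - 1\<^esup> + \<epsilon>\<^sup>2 \<bar>g P'(g)\<bar> \<bar>P\<bar>\<^bsup>2p - 2\<^esup>)\<close> with \<open>\<epsilon> = 1/(N \<eta>)\<close>.
  Since \<open>P\<close> is quadratic in \<open>g\<close>, one has \<open>\<bar>g\<bar>\<^sup>2 \<le> C (1 + \<bar>P\<bar>)\<close>; the inequality therefore closes and gives
  \<open>E \<bar>P\<bar>\<^bsup>2p\<^esup> = O(\<epsilon>\<^bsup>2p\<^esup>)\<close>. For \<open>\<eta> = N\<^bsup>-\<alpha>\<^esup>\<close> with \<open>\<alpha> < 1\<close> and \<open>p\<close> large this is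
  summable, so \<open>P \<rightarrow> 0\<close> almost surely, and \<open>Im g \<ge> 0\<close> forces \<open>g\<close> to the root of the limiting quadratic
  in the upper half plane.
\<close>

section \<open>Gaussian integration by parts\<close>

text \<open>\<open>P\<close> arises from evaluating the trace of H G, tested against a power of
  \<open>P\<close>, in two ways: algebraically, since H G = 1 + z G, and by integrating by parts in
  every entry of the array. Testing against powers of \<open>P\<close> itself estimates
  \<open>g\<close> directly, without splitting it into a mean and a fluctuation. High moments are
  needed because the bound for the second moment decays only like N^(-2(1-\<alpha>)), which is
  summable just for \<alpha> < 1/2. The analytic obstacle is uniformity: \<open>1 / Im z\<close>
  diverges with N, so crude resolvent bounds can only justify integrals and derivatives, while every
  error term has to be estimated through the trace identity. The probabilistic obstacle is that the
  hypotheses speak of linear combinations: the product law of finitely many entries must be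
  extracted before Fubini can isolate one of them.\<close>

abbreviation gauss :: "real \<Rightarrow> real measure" where
  "gauss u \<equiv> density lborel (\<lambda>x. ennreal (normal_density 0 u x))"

lemma gauss_square_integrable:
  assumes "u > 0"
  shows "integrable (gauss u) (\<lambda>t. t\<^sup>2)"
proof -
  interpret prob_space "gauss u" using assms by (rule prob_space_normal_density)
  show ?thesis
    using integrable_normal_moment[OF assms, of 0 2] by (subst integrable_density) auto
qed

lemma gauss_affine_bound_integrable:
  fixes f :: "real \<Rightarrow> complex"
  assumes "u > 0" and [measurable]: "f \<in> borel_measurable borel"
    and bound: "\<And>t. cmod (f t) \<le> a + b * t\<^sup>2"
  shows "integrable (gauss u) f"
proof -
  interpret prob_space "gauss u" using assms(1) by (rule prob_space_normal_density)
  have "integrable (gauss u) (\<lambda>t. a + b * t\<^sup>2)"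
    using gauss_square_integrable[OF assms(1)] by auto
  then show ?thesis
  proof (rule Bochner_Integration.integrable_bound)
    show "AE t in gauss u. norm (f t) \<le> norm (a + b * t\<^sup>2)"
      using bound by (intro AE_I2) (metis norm_ge_zero order_trans real_norm_def abs_of_nonneg)
  qed simp
qed

lemma gauss_integration_by_parts:
  fixes f f' :: "real \<Rightarrow> complex"
  assumes u: "u > 0" and deriv: "\<And>t. (f has_vector_derivative f' t) (at t)"
    and [measurable]: "f \<in> borel_measurable borel" "f' \<in> borel_measurable borel"
    and bound: "\<And>t. cmod (f t) \<le> a + b * t\<^sup>2"
    and int: "integrable (gauss u) (\<lambda>t. t * f t)" "integrable (gauss u) f'"
  shows "(\<integral>t. t * f t \<partial>gauss u) = u\<^sup>2 * (\<integral>t. f' t \<partial>gauss u)"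
proof -
  let ?\<phi> = "normal_density 0 u"
  define F where "F t = ?\<phi> t *\<^sub>R f t" for t
  \<comment> \<open>\<open>F'\<close> is the derivative of \<open>F\<close>, because the density
    satisfies \<phi>' = -(t/u^2) \<phi>. Its integral over the line is zero, and that equation is
    the claim divided by u^2.\<close>
  define F' where "F' t = ?\<phi> t *\<^sub>R f' t + (- (t / u\<^sup>2) * ?\<phi> t) *\<^sub>R f t" for t
  have i1: "integrable lborel (\<lambda>t. ?\<phi> t *\<^sub>R f' t)"
    using int(2) by (subst (asm) integrable_density) auto
  have i2: "integrable lborel (\<lambda>t. ?\<phi> t *\<^sub>R (t * f t))"
    using int(1) by (subst (asm) integrable_density) auto
  have F'_eq: "F' = (\<lambda>t. ?\<phi> t *\<^sub>R f' t - complex_of_real (1 / u\<^sup>2) * (?\<phi> t *\<^sub>R (t * f t)))"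
    by (auto simp: F'_def fun_eq_iff scaleR_conv_of_real)
  have iF': "integrable lborel F'"
    unfolding F'_eq by (intro Bochner_Integration.integrable_diff integrable_mult_right i1 i2)
  have \<phi>_deriv: "(?\<phi> has_real_derivative - (t / u\<^sup>2) * ?\<phi> t) (at t)" for t
    unfolding normal_density_def using u
    by (auto intro!: derivative_eq_intros simp: field_simps power2_eq_square)
  have F_deriv: "(F has_vector_derivative F' t) (at t)" for t
    unfolding F_def[abs_def] F'_def
    using has_vector_derivative_scaleR[OF \<phi>_deriv deriv] .
  have F_lim: "(\<lambda>n. F (real n)) \<longlonglongrightarrow> 0" "(\<lambda>n. F (- real n)) \<longlonglongrightarrow> 0"
  proof -
    have u2: "0 < u * u" using u by simp
    have lim: "(\<lambda>n. ?\<phi> (real n) * (a + b * (real n)\<^sup>2)) \<longlonglongrightarrow> 0"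
      unfolding normal_density_def power2_eq_square using u u2 by real_asymp
    have le: "norm (F t) \<le> ?\<phi> t * (a + b * t\<^sup>2)" for t
      unfolding F_def by (auto intro!: mult_left_mono bound)
    have sym: "?\<phi> (- t) = ?\<phi> t" for t by (simp add: normal_density_def)
    show "(\<lambda>n. F (real n)) \<longlonglongrightarrow> 0"
      by (rule Lim_null_comparison[OF _ lim]) (use le in auto)
    show "(\<lambda>n. F (- real n)) \<longlonglongrightarrow> 0"
      by (rule Lim_null_comparison[OF _ lim]) (use le[of "- real n" for n] sym in auto)
  qed
  \<comment> \<open>\<open>F'\<close> dominates its own truncations, so the integrals over [-n, n],
    which the fundamental theorem evaluates, converge to the Lebesgue integral.\<close>
  have "(\<lambda>n. \<integral>t. indicator {- real n..real n} t *\<^sub>R F' t \<partial>lborel) \<longlonglongrightarrow> (\<integral>t. F' t \<partial>lborel)"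
  proof (rule integral_dominated_convergence[where w = "\<lambda>t. norm (F' t)"])
    show "AE t in lborel. (\<lambda>n. indicator {- real n..real n} t *\<^sub>R F' t) \<longlonglongrightarrow> F' t"
    proof (rule AE_I2)
      fix t :: real
      have "eventually (\<lambda>n. indicator {- real n..real n} t *\<^sub>R F' t = F' t) sequentially"
        using eventually_ge_at_top[of "nat \<lceil>\<bar>t\<bar>\<rceil>"] by eventually_elim (auto simp: indicator_def; linarith)
      then show "(\<lambda>n. indicator {- real n..real n} t *\<^sub>R F' t) \<longlonglongrightarrow> F' t"
        by (rule tendsto_eventually)
    qed
  qed (use iF' in \<open>auto simp: indicator_def\<close>)
  moreover have "(\<integral>t. indicator {- real n..real n} t *\<^sub>R F' t \<partial>lborel) = F (real n) - F (- real n)" for n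
  proof -
    have "set_integrable lborel {- real n..real n} F'"
      unfolding set_integrable_def by (rule integrable_mult_indicator) (use iF' in auto)
    from set_borel_integral_eq_integral(2)[OF this]
    have "(\<integral>t. indicator {- real n..real n} t *\<^sub>R F' t \<partial>lborel) = integral {- real n..real n} F'"
      by (simp add: set_lebesgue_integral_def)
    also have "(F' has_integral F (real n) - F (- real n)) {- real n..real n}"
      by (rule fundamental_theorem_of_calculus) (auto intro: has_vector_derivative_at_within F_deriv)
    then have "integral {- real n..real n} F' = F (real n) - F (- real n)"
      by (rule integral_unique)
    finally show ?thesis .
  qed
  ultimately have "(\<lambda>n. F (real n) - F (- real n)) \<longlonglongrightarrow> (\<integral>t. F' t \<partial>lborel)" by simp
  moreover have "(\<lambda>n. F (real n) - F (- real n)) \<longlonglongrightarrow> 0 - 0"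
    by (intro tendsto_diff F_lim)
  ultimately have "(\<integral>t. F' t \<partial>lborel) = 0" using LIMSEQ_unique by fastforce
  then have "(\<integral>t. ?\<phi> t *\<^sub>R f' t \<partial>lborel) = complex_of_real (1 / u\<^sup>2) * (\<integral>t. ?\<phi> t *\<^sub>R (t * f t) \<partial>lborel)"
    unfolding F'_eq Bochner_Integration.integral_diff[OF i1 integrable_mult_right[OF i2]] integral_mult_right_zero
    by simp
  then have "(\<integral>t. f' t \<partial>gauss u) = complex_of_real (1 / u\<^sup>2) * (\<integral>t. t * f t \<partial>gauss u)"
    by (subst (1 2) integral_density) auto
  then show ?thesis using u by simp
qed

text \<open>A single dominating function for everything of degree at most two in the coordinates:
  the summand 1 takes care of constants and, together with the squares, of linear terms.\<close>

definition quad_dom :: "'i set \<Rightarrow> ('i \<Rightarrow> real) \<Rightarrow> real" where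
  "quad_dom I x = 1 + (\<Sum>j\<in>I. (x j)\<^sup>2)"

lemma quad_dom_ge:
  assumes "finite I" "i \<in> I" "j \<in> I"
  shows "1 \<le> quad_dom I x" "\<bar>x i\<bar> \<le> quad_dom I x" "\<bar>x i\<bar> * \<bar>x j\<bar> \<le> quad_dom I x"
proof -
  have le: "(x k)\<^sup>2 \<le> (\<Sum>j\<in>I. (x j)\<^sup>2)" if "k \<in> I" for k
    using assms that by (intro member_le_sum) auto
  show "1 \<le> quad_dom I x" by (simp add: quad_dom_def sum_nonneg)
  have "2 * \<bar>x i\<bar> \<le> 1 + (x i)\<^sup>2" using sum_squares_bound[of 1 "\<bar>x i\<bar>"] by simp
  then show "\<bar>x i\<bar> \<le> quad_dom I x" using le[OF assms(2)] unfolding quad_dom_def by linarith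
  have "2 * (\<bar>x i\<bar> * \<bar>x j\<bar>) \<le> (x i)\<^sup>2 + (x j)\<^sup>2" using sum_squares_bound[of "\<bar>x i\<bar>" "\<bar>x j\<bar>"] by simp
  then show "\<bar>x i\<bar> * \<bar>x j\<bar> \<le> quad_dom I x" using le[OF assms(2)] le[OF assms(3)] unfolding quad_dom_def by linarith
qed

lemma quad_dom_integrable:
  assumes u: "u > 0" and I: "finite I"
  shows "integrable (PiM I (\<lambda>_. gauss u)) (quad_dom I)"
proof -
  interpret prob_space "gauss u" using u by (rule prob_space_normal_density)
  interpret P: product_prob_space "\<lambda>_. gauss u" I ..
  have "integrable (PiM I (\<lambda>_. gauss u)) (\<lambda>x. (x i)\<^sup>2)" if "i \<in> I" for i
  proof -
    have "integrable (distr (PiM I (\<lambda>_. gauss u)) (gauss u) (\<lambda>x. x i)) (\<lambda>t. t\<^sup>2)"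
      using P.PiM_component[OF that] gauss_square_integrable[OF u] by simp
    then show ?thesis by (subst (asm) integrable_distr_eq) (use that in auto)
  qed
  then show ?thesis unfolding quad_dom_def[abs_def]
    by (intro Bochner_Integration.integrable_add Bochner_Integration.integrable_sum) auto
qed

lemma quad_dom_bound_integrable:
  fixes f :: "('i \<Rightarrow> real) \<Rightarrow> complex"
  assumes u: "u > 0" and I: "finite I" and "f \<in> borel_measurable (PiM I (\<lambda>_. borel))"
    and bound: "\<And>x. cmod (f x) \<le> C * quad_dom I x"
  shows "integrable (PiM I (\<lambda>_. gauss u)) f"
proof -
  have [measurable]: "f \<in> borel_measurable (PiM I (\<lambda>_. gauss u))"
    using assms(3) by (simp cong: measurable_cong_sets sets_PiM_cong)
  have "integrable (PiM I (\<lambda>_. gauss u)) (\<lambda>x. C * quad_dom I x)"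
    using quad_dom_integrable[OF u I] by simp
  then show ?thesis
  proof (rule Bochner_Integration.integrable_bound)
    show "AE x in PiM I (\<lambda>_. gauss u). norm (f x) \<le> norm (C * quad_dom I x)"
      using bound by (intro AE_I2) (metis norm_ge_zero order_trans real_norm_def abs_of_nonneg)
  qed simp
qed

text \<open>Fubini freezes all coordinates but \<open>i\<close> and reduces the claim to one
  dimension. \<open>f\<close> may grow linearly and \<open>f'\<close> quadratically, so that
  \<open>x i * f x\<close> and \<open>f'\<close> are both dominated by multiples of
  \<open>quad_dom I\<close>.\<close>

lemma PiM_gauss_integration_by_parts:
  fixes f f' :: "('i \<Rightarrow> real) \<Rightarrow> complex"
  assumes u: "u > 0" and I: "finite I" "i \<in> I"
    and deriv: "\<And>x. ((\<lambda>t. f (x(i := t))) has_vector_derivative f' x) (at (x i))"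
    and f: "f \<in> borel_measurable (PiM I (\<lambda>_. borel))" and f': "f' \<in> borel_measurable (PiM I (\<lambda>_. borel))"
    and bound: "\<And>x. cmod (f x) \<le> C * (1 + (\<Sum>j\<in>I. \<bar>x j\<bar>))"
    and bound': "\<And>x. cmod (f' x) \<le> C * quad_dom I x"
  shows "integrable (PiM I (\<lambda>_. gauss u)) (\<lambda>x. x i * f x)" (is ?A)
    and "integrable (PiM I (\<lambda>_. gauss u)) f'" (is ?B)
    and "(\<integral>x. x i * f x \<partial>PiM I (\<lambda>_. gauss u)) = u\<^sup>2 * (\<integral>x. f' x \<partial>PiM I (\<lambda>_. gauss u))" (is ?C)
proof -
  have [simp]: "i \<in> I" by fact
  interpret prob_space "gauss u" using u by (rule prob_space_normal_density)
  interpret product_sigma_finite "\<lambda>_ :: 'i. gauss u" ..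
  have C0: "0 \<le> C" using order_trans[OF norm_ge_zero bound[of "\<lambda>_. 0"]] by simp
  have [measurable]: "f \<in> borel_measurable (PiM I (\<lambda>_. borel))" by fact
  have xf: "cmod (x i * f x) \<le> C * (1 + card I) * quad_dom I x" for x
  proof -
    have "cmod (x i * f x) \<le> \<bar>x i\<bar> * (C * (1 + (\<Sum>j\<in>I. \<bar>x j\<bar>)))"
      unfolding norm_mult norm_of_real by (intro mult_left_mono bound) simp
    also have "\<dots> = C * (\<bar>x i\<bar> + (\<Sum>j\<in>I. \<bar>x i\<bar> * \<bar>x j\<bar>))"
      by (simp add: sum_distrib_left algebra_simps)
    also have "\<dots> \<le> C * (quad_dom I x + (\<Sum>j\<in>I. quad_dom I x))"
      using C0 I by (intro mult_left_mono add_mono sum_mono quad_dom_ge(2)[OF I(1,2,2)] quad_dom_ge(3)[OF I(1,2)]) auto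
    finally show ?thesis by (simp add: algebra_simps)
  qed
  show A: ?A by (rule quad_dom_bound_integrable[OF u I(1) _ xf]) measurable
  show B: ?B by (rule quad_dom_bound_integrable[OF u I(1) f' bound'])
  define J where "J = I - {i}"
  have J: "finite J" "i \<notin> J" "I = insert i J" using I by (auto simp: J_def)
  have inner: "(\<integral>t. (x(i := t)) i * f (x(i := t)) \<partial>gauss u) = u\<^sup>2 * (\<integral>t. f' (x(i := t)) \<partial>gauss u)"
    if x: "x \<in> space (PiM J (\<lambda>_. gauss u))" for x
  proof -
    have [measurable]: "(\<lambda>t. x(i := t)) \<in> measurable borel (PiM I (\<lambda>_. borel))"
    proof -
      have "x \<in> space (PiM J (\<lambda>_. borel))" using x by (simp add: space_PiM)
      then have "(\<lambda>t. (x, t)) \<in> measurable borel (PiM J (\<lambda>_. borel) \<Otimes>\<^sub>M borel)" by measurable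
      from measurable_compose[OF this measurable_add_dim] show ?thesis
        unfolding J(3) by simp
    qed
    have m: "(\<lambda>t. f (x(i := t))) \<in> borel_measurable borel" "(\<lambda>t. f' (x(i := t))) \<in> borel_measurable borel"
      using measurable_compose[OF _ f] measurable_compose[OF _ f'] by measurable
    have dom: "quad_dom I (x(i := t)) = quad_dom J x + t\<^sup>2" for t
    proof -
      have "(\<Sum>j\<in>J. ((x(i := t)) j)\<^sup>2) = (\<Sum>j\<in>J. (x j)\<^sup>2)" using J(2) by (intro sum.cong) auto
      then show ?thesis using J unfolding quad_dom_def J(3) by simp
    qed
    have flin: "cmod (f y) \<le> C * (1 + card I) * quad_dom I y" for y
    proof -
      have "cmod (f y) \<le> C * (1 + (\<Sum>j\<in>I. \<bar>y j\<bar>))" by (rule bound)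
      also have "\<dots> \<le> C * (quad_dom I y + (\<Sum>j\<in>I. quad_dom I y))"
        using C0 I by (intro mult_left_mono add_mono sum_mono quad_dom_ge(2)[OF I(1) _ I(2)] quad_dom_ge(1)[OF I(1) I(2) I(2)]) auto
      finally show ?thesis by (simp add: algebra_simps)
    qed
    have b1: "cmod (f (x(i := t))) \<le> C * (1 + card I) * quad_dom J x + C * (1 + card I) * t\<^sup>2" for t
      using flin[of "x(i := t)"] unfolding dom by (simp add: algebra_simps)
    have b2: "cmod (t * f (x(i := t))) \<le> C * (1 + card I) * quad_dom J x + C * (1 + card I) * t\<^sup>2" for t
      using xf[of "x(i := t)"] unfolding dom by (simp add: algebra_simps)
    have b3: "cmod (f' (x(i := t))) \<le> C * quad_dom J x + C * t\<^sup>2" for t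
      using bound'[of "x(i := t)"] unfolding dom by (simp add: algebra_simps)
    \<comment> \<open>The derivative is assumed only at the current value of coordinate
      \<open>i\<close>; evaluating that assumption at \<open>x(i := t)\<close> supplies it for every
      \<open>t\<close>.\<close>
    have "((\<lambda>t. f (x(i := t))) has_vector_derivative f' (x(i := t))) (at t)" for t
      using deriv[of "x(i := t)"] by simp
    from gauss_integration_by_parts[OF u this m b1 gauss_affine_bound_integrable[OF u _ b2]
        gauss_affine_bound_integrable[OF u m(2) b3]] m(1)
    show ?thesis by simp
  qed
  have "(\<integral>x. x i * f x \<partial>PiM I (\<lambda>_. gauss u)) = (\<integral>x. (\<integral>t. (x(i := t)) i * f (x(i := t)) \<partial>gauss u) \<partial>PiM J (\<lambda>_. gauss u))"
    using product_integral_insert[OF J(1,2), of "\<lambda>x. x i * f x"] A J(3) by simp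
  also have "\<dots> = (\<integral>x. u\<^sup>2 * (\<integral>t. f' (x(i := t)) \<partial>gauss u) \<partial>PiM J (\<lambda>_. gauss u))"
    using inner by (rule Bochner_Integration.integral_cong[OF refl])
  also have "\<dots> = u\<^sup>2 * (\<integral>x. (\<integral>t. f' (x(i := t)) \<partial>gauss u) \<partial>PiM J (\<lambda>_. gauss u))"
    by (rule integral_mult_right_zero)
  also have "(\<integral>x. (\<integral>t. f' (x(i := t)) \<partial>gauss u) \<partial>PiM J (\<lambda>_. gauss u)) = (\<integral>x. f' x \<partial>PiM I (\<lambda>_. gauss u))"
    using product_integral_insert[OF J(1,2), of f'] B J(3) by simp
  finally show ?C by simp
qed

section \<open>Uncorrelated jointly Gaussian variables\<close>

text \<open>A nonnegative weight \<open>Y\<close> turns \<open>M\<close> into another probability measure; the hypothesis says that the law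
  of \<open>X\<close> has the same characteristic function under both, so Levy's theorem applies.\<close>
lemma (in prob_space) weighted_law:
  fixes X Y :: "'a \<Rightarrow> real"
  assumes [measurable]: "X \<in> borel_measurable M" "A \<in> sets borel"
    and Y: "integrable M Y" "\<And>\<omega>. \<omega> \<in> space M \<Longrightarrow> 0 \<le> Y \<omega>"
    and fact: "\<And>s. (\<integral>\<omega>. Y \<omega> * iexp (s * X \<omega>) \<partial>M) = (\<integral>\<omega>. Y \<omega> \<partial>M) * (\<integral>\<omega>. iexp (s * X \<omega>) \<partial>M)"
  shows "(\<integral>\<omega>. Y \<omega> * indicator A (X \<omega>) \<partial>M) = (\<integral>\<omega>. Y \<omega> \<partial>M) * prob (X -` A \<inter> space M)"
proof (cases "(\<integral>\<omega>. Y \<omega> \<partial>M) = 0")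
  case True
  then have "AE \<omega> in M. Y \<omega> = 0"
    using integral_nonneg_eq_0_iff_AE[OF Y(1)] Y(2) by auto
  then have "(\<integral>\<omega>. Y \<omega> * indicator A (X \<omega>) \<partial>M) = 0"
    by (intro integral_eq_zero_AE) auto
  then show ?thesis using True by simp
next
  case False
  define y where "y = (\<integral>\<omega>. Y \<omega> \<partial>M)"
  have "y \<ge> 0" unfolding y_def by (rule integral_nonneg_AE) (use Y(2) in auto)
  then have y: "y > 0" using False by (simp add: y_def)
  have [measurable]: "Y \<in> borel_measurable M" using Y(1) by auto
  define M' where "M' = density M (\<lambda>\<omega>. ennreal (Y \<omega> / y))"
  have pos: "AE \<omega> in M. 0 \<le> Y \<omega> / y" using Y(2) y by auto
  have "emeasure M' (space M') = (\<integral>\<^sup>+\<omega>. ennreal (Y \<omega> / y) \<partial>M)"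
    by (simp add: M'_def emeasure_density cong: nn_integral_cong)
  also have "\<dots> = ennreal (\<integral>\<omega>. Y \<omega> / y \<partial>M)"
    using Y pos by (intro nn_integral_eq_integral) auto
  also have "\<dots> = 1" using y by (simp add: y_def[symmetric])
  finally interpret M': prob_space M' by (rule prob_spaceI)
  have [measurable]: "X \<in> borel_measurable M'" by (simp add: M'_def)
  interpret D: real_distribution "distr M borel X" by (rule real_distribution_distr) simp
  interpret D': real_distribution "distr M' borel X" by (rule M'.real_distribution_distr) simp
  have "char (distr M' borel X) s = char (distr M borel X) s" for s
  proof -
    have "char (distr M' borel X) s = (\<integral>\<omega>. (Y \<omega> / y) *\<^sub>R iexp (s * X \<omega>) \<partial>M)"
      unfolding char_def M'_def using pos by (subst integral_distr) (auto simp: integral_density)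
    also have "\<dots> = (\<integral>\<omega>. complex_of_real (1 / y) * (Y \<omega> * iexp (s * X \<omega>)) \<partial>M)"
      by (intro Bochner_Integration.integral_cong) (auto simp: scaleR_conv_of_real)
    also have "\<dots> = complex_of_real (1 / y) * (\<integral>\<omega>. Y \<omega> * iexp (s * X \<omega>) \<partial>M)"
      by simp
    also have "\<dots> = (\<integral>\<omega>. iexp (s * X \<omega>) \<partial>M)"
      unfolding fact y_def[symmetric] using y by simp
    also have "\<dots> = char (distr M borel X) s"
      unfolding char_def by (subst integral_distr) auto
    finally show ?thesis .
  qed
  then have eq: "distr M' borel X = distr M borel X"
    by (intro Levy_uniqueness D.real_distribution_axioms D'.real_distribution_axioms ext)
  have "(\<integral>\<omega>. Y \<omega> * indicator A (X \<omega>) \<partial>M) = (\<integral>\<omega>. y * ((Y \<omega> / y) *\<^sub>R indicator A (X \<omega>)) \<partial>M)"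
    using y by (intro Bochner_Integration.integral_cong) auto
  also have "\<dots> = y * (\<integral>\<omega>. (Y \<omega> / y) *\<^sub>R (indicator A (X \<omega>) :: real) \<partial>M)"
    by (rule integral_mult_right_zero)
  also have "(\<integral>\<omega>. (Y \<omega> / y) *\<^sub>R (indicator A (X \<omega>) :: real) \<partial>M) = (\<integral>\<omega>. indicator A (X \<omega>) \<partial>M')"
    unfolding M'_def using pos by (subst integral_density) auto
  also have "\<dots> = (\<integral>x. (indicator A x :: real) \<partial>distr M' borel X)"
    by (subst integral_distr) auto
  also have "\<dots> = prob (X -` A \<inter> space M)"
    unfolding eq by (simp add: measure_distr)
  finally show ?thesis by (simp add: y_def)
qed

text \<open>Since \<open>cmod (Y \<omega>) \<le> R \<omega>\<close>, the weights
  \<open>R + Re Y\<close> and \<open>R + Im Y\<close> are nonnegative and fall under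
  \<open>weighted_law\<close>. Subtracting the statement for \<open>R\<close> and recombining the
  two parts gives the one for \<open>Y\<close>.\<close>

lemma (in prob_space) weighted_law_complex:
  fixes X R :: "'a \<Rightarrow> real" and Y :: "'a \<Rightarrow> complex"
  assumes [measurable]: "X \<in> borel_measurable M" "A \<in> sets borel"
    and R: "integrable M R" and Y[measurable]: "Y \<in> borel_measurable M"
    and le: "\<And>\<omega>. \<omega> \<in> space M \<Longrightarrow> cmod (Y \<omega>) \<le> R \<omega>"
    and fR: "\<And>s. (\<integral>\<omega>. R \<omega> * iexp (s * X \<omega>) \<partial>M) = (\<integral>\<omega>. R \<omega> \<partial>M) * (\<integral>\<omega>. iexp (s * X \<omega>) \<partial>M)"
    and fY: "\<And>s. (\<integral>\<omega>. Y \<omega> * iexp (s * X \<omega>) \<partial>M) = (\<integral>\<omega>. Y \<omega> \<partial>M) * (\<integral>\<omega>. iexp (s * X \<omega>) \<partial>M)"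
  shows "(\<integral>\<omega>. Y \<omega> * indicator A (X \<omega>) \<partial>M) = (\<integral>\<omega>. Y \<omega> \<partial>M) * prob (X -` A \<inter> space M)"
proof -
  have [measurable]: "R \<in> borel_measurable M" using R by auto
  have R0: "0 \<le> R \<omega>" if "\<omega> \<in> space M" for \<omega> using le[OF that] norm_ge_zero order_trans by blast
  have iY: "integrable M Y"
    by (rule Bochner_Integration.integrable_bound[OF R]) (use le R0 in auto)
  have iE: "integrable M (\<lambda>\<omega>. f \<omega> * iexp (s * X \<omega>))" if "integrable M f" for f :: "'a \<Rightarrow> complex" and s
  proof -
    have [measurable]: "f \<in> borel_measurable M" using that by auto
    show ?thesis by (rule Bochner_Integration.integrable_bound[OF that]) (auto simp: norm_mult)
  qed
  have iA: "integrable M (\<lambda>\<omega>. f \<omega> * indicator A (X \<omega>))" if "integrable M f" for f :: "'a \<Rightarrow> real"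
  proof -
    have [measurable]: "f \<in> borel_measurable M" using that by auto
    show ?thesis by (rule Bochner_Integration.integrable_bound[OF that]) (auto simp: indicator_def)
  qed
  \<comment> \<open>Conjugating the hypothesis at \<open>- s\<close> yields the factorisation for
    \<open>cnj (Y \<omega>)\<close>, hence for the real and imaginary parts, which are linear
    combinations of \<open>Y\<close> and its conjugate.\<close>
  have fcnj: "(\<integral>\<omega>. cnj (Y \<omega>) * iexp (s * X \<omega>) \<partial>M) = (\<integral>\<omega>. cnj (Y \<omega>) \<partial>M) * (\<integral>\<omega>. iexp (s * X \<omega>) \<partial>M)" for s
    using arg_cong[OF fY[of "- s"], of cnj]
    by (simp flip: Bochner_Integration.integral_cnj add: exp_cnj)
  note [simp] = iY R iE iA
  have Rint: "(\<integral>\<omega>. R \<omega> * indicator A (X \<omega>) \<partial>M) = (\<integral>\<omega>. R \<omega> \<partial>M) * prob (X -` A \<inter> space M)"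
    by (rule weighted_law) (use fR R0 R in auto)
  have key: "(\<integral>\<omega>. Z \<omega> * indicator A (X \<omega>) \<partial>M) = (\<integral>\<omega>. Z \<omega> \<partial>M) * prob (X -` A \<inter> space M)"
    if Z: "\<And>\<omega>. complex_of_real (Z \<omega>) = a * Y \<omega> + b * cnj (Y \<omega>)" and Zle: "\<And>\<omega>. \<bar>Z \<omega>\<bar> \<le> cmod (Y \<omega>)"
    and Zi: "integrable M Z" for Z :: "'a \<Rightarrow> real" and a b
  proof -
    have "(\<integral>\<omega>. (R \<omega> + Z \<omega>) * indicator A (X \<omega>) \<partial>M) = (\<integral>\<omega>. R \<omega> + Z \<omega> \<partial>M) * prob (X -` A \<inter> space M)"
    proof (rule weighted_law)
      show "0 \<le> R \<omega> + Z \<omega>" if "\<omega> \<in> space M" for \<omega> using le[OF that] Zle[of \<omega>] by linarith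
      fix s
      define e where "e \<omega> = iexp (s * X \<omega>)" for \<omega>
      have ie: "integrable M (\<lambda>\<omega>. R \<omega> * e \<omega>)" "integrable M (\<lambda>\<omega>. Y \<omega> * e \<omega>)" "integrable M (\<lambda>\<omega>. cnj (Y \<omega>) * e \<omega>)"
        unfolding e_def by (rule iE; simp)+
      have "(\<integral>\<omega>. (R \<omega> + Z \<omega>) * iexp (s * X \<omega>) \<partial>M) = (\<integral>\<omega>. R \<omega> * iexp (s * X \<omega>) +
          (a * (Y \<omega> * iexp (s * X \<omega>)) + b * (cnj (Y \<omega>) * iexp (s * X \<omega>))) \<partial>M)"
        by (simp add: Z algebra_simps)
      also have "\<dots> = (\<integral>\<omega>. R \<omega> * iexp (s * X \<omega>) \<partial>M) +
          (a * (\<integral>\<omega>. Y \<omega> * iexp (s * X \<omega>) \<partial>M) + b * (\<integral>\<omega>. cnj (Y \<omega>) * iexp (s * X \<omega>) \<partial>M))"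
        using ie unfolding e_def[symmetric] by simp
      also have "\<dots> = ((\<integral>\<omega>. R \<omega> \<partial>M) + (a * (\<integral>\<omega>. Y \<omega> \<partial>M) + b * (\<integral>\<omega>. cnj (Y \<omega>) \<partial>M))) * (\<integral>\<omega>. iexp (s * X \<omega>) \<partial>M)"
        unfolding fR fY fcnj by (simp add: algebra_simps)
      also have "a * (\<integral>\<omega>. Y \<omega> \<partial>M) + b * (\<integral>\<omega>. cnj (Y \<omega>) \<partial>M) = (\<integral>\<omega>. complex_of_real (Z \<omega>) \<partial>M)"
        unfolding Z by (subst Bochner_Integration.integral_add) simp_all
      finally show "(\<integral>\<omega>. (R \<omega> + Z \<omega>) * iexp (s * X \<omega>) \<partial>M) = (\<integral>\<omega>. R \<omega> + Z \<omega> \<partial>M) * (\<integral>\<omega>. iexp (s * X \<omega>) \<partial>M)"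
        using Zi R by simp
    qed (use Zi R in auto)
    then show ?thesis using Rint Zi R by (simp add: algebra_simps)
  qed
  have re: "(\<integral>\<omega>. Re (Y \<omega>) * indicator A (X \<omega>) \<partial>M) = (\<integral>\<omega>. Re (Y \<omega>) \<partial>M) * prob (X -` A \<inter> space M)"
    by (rule key[of _ "1/2" "1/2"]) (auto simp: complex_eq_iff abs_Re_le_cmod)
  have im: "(\<integral>\<omega>. Im (Y \<omega>) * indicator A (X \<omega>) \<partial>M) = (\<integral>\<omega>. Im (Y \<omega>) \<partial>M) * prob (X -` A \<inter> space M)"
    by (rule key[of _ "- \<i>/2" "\<i>/2"]) (auto simp: complex_eq_iff abs_Im_le_cmod)
  have ind: "indicator A x = complex_of_real (indicator A x)" for x :: real by (simp add: indicator_def)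
  have iYA: "integrable M (\<lambda>\<omega>. Y \<omega> * indicator A (X \<omega>))"
    by (rule Bochner_Integration.integrable_bound[OF iY]) (auto simp: indicator_def)
  show ?thesis
  proof (rule complex_eqI)
    show "Re (\<integral>\<omega>. Y \<omega> * indicator A (X \<omega>) \<partial>M) = Re ((\<integral>\<omega>. Y \<omega> \<partial>M) * prob (X -` A \<inter> space M))"
      using re iYA by (simp flip: integral_Re add: ind)
    show "Im (\<integral>\<omega>. Y \<omega> * indicator A (X \<omega>) \<partial>M) = Im ((\<integral>\<omega>. Y \<omega> \<partial>M) * prob (X -` A \<inter> space M))"
      using im iYA by (simp flip: integral_Im add: ind)
  qed
qed

section \<open>Second moments and characteristic functions of Gaussian variables\<close>

lemma (in prob_space) gaussian_rv_square_integrable: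
  assumes "gaussian_rv M S"
  shows "integrable M (\<lambda>\<omega>. (S \<omega>)\<^sup>2)" "integrable M S"
proof -
  have [measurable]: "S \<in> borel_measurable M" using assms by (simp add: gaussian_rv_def)
  show sq: "integrable M (\<lambda>\<omega>. (S \<omega>)\<^sup>2)"
  proof (cases "\<exists>a. AE \<omega> in M. S \<omega> = a")
    case True
    then obtain a where "AE \<omega> in M. S \<omega> = a" by auto
    then have "AE \<omega> in M. a\<^sup>2 = (S \<omega>)\<^sup>2" by eventually_elim simp
    then show ?thesis
      by (rule integrable_cong_AE_imp[rotated 2]) simp_all
  next
    case False
    then obtain a \<sigma> where \<sigma>: "\<sigma> > 0" and D: "distributed M lborel S (\<lambda>t. ennreal (normal_density a \<sigma> t))"
      using assms by (auto simp: gaussian_rv_def)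
    have "integrable lborel (\<lambda>x. normal_density a \<sigma> x * x\<^sup>2)"
    proof -
      have "integrable lborel (\<lambda>x. normal_density a \<sigma> x * (x - a)^2 + 2 * a * (normal_density a \<sigma> x * (x - a)^1)
         + a\<^sup>2 * (normal_density a \<sigma> x * (x - a)^0))"
        by (intro Bochner_Integration.integrable_add integrable_mult_right integrable_normal_moment \<sigma>)
      also have "(\<lambda>x. normal_density a \<sigma> x * (x - a)^2 + 2 * a * (normal_density a \<sigma> x * (x - a)^1)
         + a\<^sup>2 * (normal_density a \<sigma> x * (x - a)^0)) = (\<lambda>x. normal_density a \<sigma> x * x\<^sup>2)"
        by (auto simp: fun_eq_iff power2_eq_square algebra_simps)
      finally show ?thesis .
    qed
    then show ?thesis
      using distributed_integrable[OF D, of "\<lambda>x. x\<^sup>2"] by auto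
  qed
  show "integrable M S" by (rule square_integrable_imp_integrable[OF _ sq]) simp
qed

text \<open>A centred Gaussian law is fixed by its variance. The point mass at 0 is the case
  \<open>v = 0\<close> of the exponential formula; only the density needs
  \<open>v > 0\<close>.\<close>

lemma (in prob_space) gaussian_rv_char:
  assumes G: "gaussian_rv M S" and mean: "expectation S = 0" and var: "expectation (\<lambda>\<omega>. (S \<omega>)\<^sup>2) = v"
  shows "(\<integral>\<omega>. iexp (S \<omega>) \<partial>M) = complex_of_real (exp (- v / 2))"
    and "v > 0 \<Longrightarrow> distributed M lborel S (\<lambda>t. ennreal (normal_density 0 (sqrt v) t))"
proof -
  have [measurable]: "S \<in> borel_measurable M" using G by (simp add: gaussian_rv_def)
  have "(\<integral>\<omega>. iexp (S \<omega>) \<partial>M) = complex_of_real (exp (- v / 2)) \<and>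
     (v > 0 \<longrightarrow> distributed M lborel S (\<lambda>t. ennreal (normal_density 0 (sqrt v) t)))"
  proof (cases "\<exists>a. AE \<omega> in M. S \<omega> = a")
    case True
    then obtain a where a: "AE \<omega> in M. S \<omega> = a" by auto
    have "expectation S = expectation (\<lambda>_. a)" using a by (intro integral_cong_AE) auto
    then have [simp]: "a = 0" using mean by (simp add: prob_space)
    have "expectation (\<lambda>\<omega>. (S \<omega>)\<^sup>2) = expectation (\<lambda>_. a\<^sup>2)" using a by (intro integral_cong_AE) auto
    then have [simp]: "v = 0" using var by simp
    have "(\<integral>\<omega>. iexp (S \<omega>) \<partial>M) = (\<integral>\<omega>. 1 \<partial>M)"
      using a by (intro integral_cong_AE) (auto elim!: eventually_mono)
    then show ?thesis by (simp add: prob_space)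
  next
    case False
    then obtain a \<sigma> where \<sigma>: "\<sigma> > 0" and D: "distributed M lborel S (\<lambda>t. ennreal (normal_density a \<sigma> t))"
      using G by (auto simp: gaussian_rv_def)
    have a: "a = 0" using normal_distributed_expectation[OF \<sigma> D] mean by simp
    have v: "v = \<sigma>\<^sup>2" using normal_distributed_variance[OF \<sigma> D] mean var by simp
    have sv: "sqrt v = \<sigma>" using \<sigma> v by simp
    have D1: "distributed M lborel (\<lambda>x. (S x - a) / \<sigma>) (\<lambda>x. ennreal (std_normal_density x))"
      using D \<sigma> normal_standard_normal_convert[OF \<sigma>, of S a] by simp
    have eqd: "distr M borel (\<lambda>x. S x / \<sigma>) = std_normal_distribution"
    proof -
      have "distr M borel (\<lambda>x. S x / \<sigma>) = distr M lborel (\<lambda>x. (S x - a) / \<sigma>)"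
        by (intro distr_cong) (simp_all add: a)
      then show ?thesis using distributed_distr_eq_density[OF D1] by simp
    qed
    have "(\<integral>\<omega>. iexp (S \<omega>) \<partial>M) = (\<integral>\<omega>. iexp (\<sigma> * (S \<omega> / \<sigma>)) \<partial>M)"
      using \<sigma> by simp
    also have "\<dots> = char (distr M borel (\<lambda>x. S x / \<sigma>)) \<sigma>"
      unfolding char_def by (subst integral_distr) auto
    also have "\<dots> = complex_of_real (exp (- v / 2))"
      unfolding eqd char_std_normal_distribution v by simp
    finally show ?thesis using D a sv by simp
  qed
  then show "(\<integral>\<omega>. iexp (S \<omega>) \<partial>M) = complex_of_real (exp (- v / 2))"
    and "v > 0 \<Longrightarrow> distributed M lborel S (\<lambda>t. ennreal (normal_density 0 (sqrt v) t))" by auto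
qed

locale gaussian_family = prob_space +
  fixes X :: "'i \<Rightarrow> 'a \<Rightarrow> real" and u :: real
  assumes u_pos: "u > 0"
    and joint: "jointly_gaussian M UNIV X"
    and mean: "\<And>i. expectation (X i) = 0"
    and cov: "\<And>i j. expectation (\<lambda>\<omega>. X i \<omega> * X j \<omega>) = (if i = j then u\<^sup>2 else 0)"
begin

lemma combination_gaussian: "finite L \<Longrightarrow> gaussian_rv M (\<lambda>\<omega>. \<Sum>i\<in>L. t i * X i \<omega>)"
  using joint by (auto simp: jointly_gaussian_def)

lemma X_gaussian: "gaussian_rv M (X i)"
  using combination_gaussian[of "{i}" "\<lambda>_. 1"] by simp

lemma X_measurable [measurable]: "X i \<in> borel_measurable M"
  using X_gaussian[of i] by (simp add: gaussian_rv_def)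

lemma X_distr: "distr M borel (X i) = gauss u"
proof -
  have "distributed M lborel (X i) (\<lambda>t. ennreal (normal_density 0 (sqrt (u\<^sup>2)) t))"
    using u_pos cov[of i i] by (intro gaussian_rv_char(2)[OF X_gaussian mean]) (auto simp: power2_eq_square)
  then have "distr M lborel (X i) = gauss u"
    using u_pos by (auto dest!: distributed_distr_eq_density)
  then show ?thesis by (simp cong: distr_cong)
qed

lemma X_mult_integrable: "integrable M (\<lambda>\<omega>. X i \<omega> * X j \<omega>)"
proof -
  have "integrable M (\<lambda>\<omega>. (X i \<omega>)\<^sup>2 + (X j \<omega>)\<^sup>2)"
    by (intro Bochner_Integration.integrable_add gaussian_rv_square_integrable X_gaussian)
  then show ?thesis
  proof (rule Bochner_Integration.integrable_bound)
    have "\<bar>a * b\<bar> \<le> a\<^sup>2 + b\<^sup>2" for a b :: real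
    proof -
      have "2 * (\<bar>a\<bar> * \<bar>b\<bar>) \<le> a\<^sup>2 + b\<^sup>2" using sum_squares_bound[of "\<bar>a\<bar>" "\<bar>b\<bar>"] by simp
      moreover have "0 \<le> \<bar>a\<bar> * \<bar>b\<bar>" by simp
      ultimately show ?thesis unfolding abs_mult by linarith
    qed
    then show "AE \<omega> in M. norm (X i \<omega> * X j \<omega>) \<le> norm ((X i \<omega>)\<^sup>2 + (X j \<omega>)\<^sup>2)" by simp
  qed simp
qed

text \<open>The covariance is diagonal, so the variance in the exponent is additive over the index
  set. This is the form in which vanishing correlations enter \<open>independence\<close>.\<close>

lemma combination_char:
  assumes "finite L"
  shows "(\<integral>\<omega>. iexp (\<Sum>i\<in>L. t i * X i \<omega>) \<partial>M) = complex_of_real (exp (- (\<Sum>i\<in>L. u\<^sup>2 * (t i)\<^sup>2) / 2))"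
proof (rule gaussian_rv_char(1)[OF combination_gaussian[OF assms]])
  show "expectation (\<lambda>\<omega>. \<Sum>i\<in>L. t i * X i \<omega>) = 0"
    using gaussian_rv_square_integrable(2)[OF X_gaussian] by (simp add: mean)
  have "expectation (\<lambda>\<omega>. (\<Sum>i\<in>L. t i * X i \<omega>)\<^sup>2) = expectation (\<lambda>\<omega>. \<Sum>i\<in>L. \<Sum>j\<in>L. (t i * t j) * (X i \<omega> * X j \<omega>))"
    by (simp add: power2_eq_square sum_product algebra_simps)
  also have "\<dots> = (\<Sum>i\<in>L. \<Sum>j\<in>L. (t i * t j) * expectation (\<lambda>\<omega>. X i \<omega> * X j \<omega>))"
    using X_mult_integrable by simp
  also have "\<dots> = (\<Sum>i\<in>L. u\<^sup>2 * (t i)\<^sup>2)"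
    using assms by (simp add: cov mult_delta_right power2_eq_square algebra_simps)
  finally show "expectation (\<lambda>\<omega>. (\<Sum>i\<in>L. t i * X i \<omega>)\<^sup>2) = (\<Sum>i\<in>L. u\<^sup>2 * (t i)\<^sup>2)" .
qed

text \<open>Joint Gaussianity only supplies characteristic functions. They are traded for indicators one
  coordinate at a time, which needs nothing beyond the one-dimensional uniqueness theorem.\<close>
lemma independence:
  assumes "finite K" "finite L" "K \<inter> L = {}" "\<And>i. A i \<in> sets borel"
  shows "(\<integral>\<omega>. complex_of_real (\<Prod>i\<in>K. indicator (A i) (X i \<omega>)) * iexp (\<Sum>i\<in>L. t i * X i \<omega>) \<partial>M)
     = complex_of_real (\<Prod>i\<in>K. prob (X i -` A i \<inter> space M)) * (\<integral>\<omega>. iexp (\<Sum>i\<in>L. t i * X i \<omega>) \<partial>M)"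
  using assms(1,2,3)
proof (induction K arbitrary: L t rule: finite_induct)
  case empty
  then show ?case by simp
next
  case (insert k K)
  note [measurable] = assms(4)
  let ?I = "\<lambda>\<omega>. \<Prod>i\<in>K. indicator (A i) (X i \<omega>) :: real"
  let ?p = "complex_of_real (\<Prod>i\<in>K. prob (X i -` A i \<inter> space M))"
  have k: "k \<notin> L" and KL: "K \<inter> insert k L = {}" "K \<inter> L = {}" using insert by auto
  \<comment> \<open>Writing the new frequency \<open>s\<close> into \<open>t\<close> at
    \<open>k\<close> lets the induction hypothesis act on \<open>insert k L\<close>, after which the
    factor of \<open>X k\<close> splits off. The case \<open>L = {}\<close> serves the dominating
    weight \<open>?I\<close>, the given \<open>L\<close> the complex weight.\<close>
  have fac: "(\<integral>\<omega>. ?I \<omega> * iexp (\<Sum>i\<in>L. t i * X i \<omega>) * iexp (s * X k \<omega>) \<partial>M)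
     = (\<integral>\<omega>. ?I \<omega> * iexp (\<Sum>i\<in>L. t i * X i \<omega>) \<partial>M) * (\<integral>\<omega>. iexp (s * X k \<omega>) \<partial>M)"
    if "finite L" "k \<notin> L" "K \<inter> insert k L = {}" "K \<inter> L = {}" for s L and t :: "'i \<Rightarrow> real"
  proof -
    have upd: "(\<Sum>i\<in>insert k L. (t(k := s)) i * X i \<omega>) = s * X k \<omega> + (\<Sum>i\<in>L. t i * X i \<omega>)" for \<omega>
      using that by (auto intro!: sum.cong)
    have upd2: "(\<Sum>i\<in>insert k L. u\<^sup>2 * ((t(k := s)) i)\<^sup>2) = u\<^sup>2 * s\<^sup>2 + (\<Sum>i\<in>L. u\<^sup>2 * (t i)\<^sup>2)"
      using that by (auto intro!: sum.cong)
    have "(\<integral>\<omega>. ?I \<omega> * iexp (\<Sum>i\<in>L. t i * X i \<omega>) * iexp (s * X k \<omega>) \<partial>M)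
      = (\<integral>\<omega>. ?I \<omega> * iexp (\<Sum>i\<in>insert k L. (t(k := s)) i * X i \<omega>) \<partial>M)"
      unfolding upd by (simp add: exp_add ring_distribs mult_ac)
    also have "\<dots> = ?p * (\<integral>\<omega>. iexp (\<Sum>i\<in>insert k L. (t(k := s)) i * X i \<omega>) \<partial>M)"
      using that by (intro insert.IH) auto
    also have "\<dots> = ?p * (\<integral>\<omega>. iexp (\<Sum>i\<in>L. t i * X i \<omega>) \<partial>M) * (\<integral>\<omega>. iexp (s * X k \<omega>) \<partial>M)"
      using that combination_char[of L t] combination_char[of "insert k L" "t(k := s)"]
        combination_char[of "{k}" "\<lambda>_. s"] unfolding upd2
      by (simp add: exp_add[symmetric] add_divide_distrib of_real_mult[symmetric] del: of_real_mult)
    finally show ?thesis using that by (subst insert.IH) auto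
  qed
  have ile: "0 \<le> ?I \<omega>" "?I \<omega> \<le> 1" for \<omega>
    by (auto intro!: prod_nonneg prod_le_1)
  have "(\<integral>\<omega>. (?I \<omega> * iexp (\<Sum>i\<in>L. t i * X i \<omega>)) * indicator (A k) (X k \<omega>) \<partial>M)
    = (\<integral>\<omega>. ?I \<omega> * iexp (\<Sum>i\<in>L. t i * X i \<omega>) \<partial>M) * prob (X k -` A k \<inter> space M)"
  proof (rule weighted_law_complex[where R = ?I])
    show "integrable M ?I"
      by (rule integrable_const_bound[where B = 1]) (use ile in auto)
    show "(\<integral>\<omega>. complex_of_real (?I \<omega>) * iexp (s * X k \<omega>) \<partial>M) = (\<integral>\<omega>. ?I \<omega> \<partial>M) * (\<integral>\<omega>. iexp (s * X k \<omega>) \<partial>M)" for s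
      using fac[of "{}" t s] insert by (simp del: of_real_prod)
    show "cmod (?I \<omega> * iexp (\<Sum>i\<in>L. t i * X i \<omega>)) \<le> ?I \<omega>" for \<omega>
      using ile[of \<omega>] by (simp add: norm_mult del: of_real_prod)
    show "(\<integral>\<omega>. ?I \<omega> * iexp (\<Sum>i\<in>L. t i * X i \<omega>) * iexp (s * X k \<omega>) \<partial>M)
     = (\<integral>\<omega>. ?I \<omega> * iexp (\<Sum>i\<in>L. t i * X i \<omega>) \<partial>M) * (\<integral>\<omega>. iexp (s * X k \<omega>) \<partial>M)" for s
      using fac[of L t s] KL k insert.prems by simp
  qed measurable
  also have "(\<integral>\<omega>. ?I \<omega> * iexp (\<Sum>i\<in>L. t i * X i \<omega>) \<partial>M) = ?p * (\<integral>\<omega>. iexp (\<Sum>i\<in>L. t i * X i \<omega>) \<partial>M)"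
    using insert KL by auto
  also have "(\<lambda>\<omega>. (?I \<omega> * iexp (\<Sum>i\<in>L. t i * X i \<omega>)) * indicator (A k) (X k \<omega>))
    = (\<lambda>\<omega>. complex_of_real (\<Prod>i\<in>insert k K. indicator (A i) (X i \<omega>)) * iexp (\<Sum>i\<in>L. t i * X i \<omega>))"
    using insert by (auto simp: fun_eq_iff indicator_def)
  finally show ?case using insert by (simp add: mult_ac)
qed

lemma distr_PiM_gauss:
  assumes "finite I"
  shows "distr M (PiM I (\<lambda>_. gauss u)) (\<lambda>\<omega>. \<lambda>i\<in>I. X i \<omega>) = PiM I (\<lambda>_. gauss u)"
proof -
  interpret P: prob_space "gauss u" using u_pos by (rule prob_space_normal_density)
  interpret product_sigma_finite "\<lambda>_ :: 'i. gauss u" ..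
  show ?thesis
  proof (rule PiM_eqI[OF assms])
    fix A :: "'i \<Rightarrow> real set" assume A: "\<And>i. i \<in> I \<Longrightarrow> A i \<in> sets (gauss u)"
    \<comment> \<open>\<open>independence\<close> asks for Borel sets at all indices, whereas
      \<open>A\<close> is controlled on \<open>I\<close> only; outside \<open>I\<close> any Borel
      set will do.\<close>
    define B where "B i = (if i \<in> I then A i else {})" for i
    have B[measurable]: "B i \<in> sets borel" for i using A by (auto simp: B_def)
    have "emeasure (distr M (PiM I (\<lambda>_. gauss u)) (\<lambda>\<omega>. \<lambda>i\<in>I. X i \<omega>)) (Pi\<^sub>E I A)
      = emeasure M ((\<lambda>\<omega>. \<lambda>i\<in>I. X i \<omega>) -` (Pi\<^sub>E I A) \<inter> space M)"
      using A assms by (intro emeasure_distr sets_PiM_I_finite) (auto intro!: measurable_restrict)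
    also have "(\<lambda>\<omega>. \<lambda>i\<in>I. X i \<omega>) -` (Pi\<^sub>E I A) \<inter> space M = {\<omega>\<in>space M. \<forall>i\<in>I. X i \<omega> \<in> B i}"
      by (auto simp: B_def PiE_iff)
    also have "emeasure M \<dots> = ennreal (prob {\<omega>\<in>space M. \<forall>i\<in>I. X i \<omega> \<in> B i})"
      by (rule emeasure_eq_measure)
    also have "prob {\<omega>\<in>space M. \<forall>i\<in>I. X i \<omega> \<in> B i} = (\<integral>\<omega>. indicator {\<omega>\<in>space M. \<forall>i\<in>I. X i \<omega> \<in> B i} \<omega> \<partial>M)"
      using assms by simp
    also have "\<dots> = (\<integral>\<omega>. (\<Prod>i\<in>I. indicator (B i) (X i \<omega>)) \<partial>M)"
      using assms by (intro Bochner_Integration.integral_cong) (auto simp: indicator_def prod_zero_iff)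
    also have "\<dots> = (\<Prod>i\<in>I. prob (X i -` B i \<inter> space M))"
      using independence[OF assms finite.emptyI, of B] B
      by (simp add: prob_space del: of_real_prod)
    also have "ennreal \<dots> = (\<Prod>i\<in>I. emeasure M (X i -` B i \<inter> space M))"
      by (simp add: emeasure_eq_measure prod_ennreal)
    also have "\<dots> = (\<Prod>i\<in>I. emeasure (distr M borel (X i)) (A i))"
      using A by (intro prod.cong refl) (subst emeasure_distr, auto simp: B_def)
    finally show "emeasure (distr M (PiM I (\<lambda>_. gauss u)) (\<lambda>\<omega>. \<lambda>i\<in>I. X i \<omega>)) (Pi\<^sub>E I A) = (\<Prod>i\<in>I. emeasure (gauss u) (A i))"
      unfolding X_distr .
  qed simp
qed

end

section \<open>Resolvents of sample covariance matrices\<close>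

text \<open>The resolvent identity produces an exact difference quotient \<open>\<phi>\<close>, so
  differentiating the resolvent comes down to continuity of \<open>\<phi>\<close> at one
  point.\<close>

lemma has_vector_derivative_caratheodory:
  fixes f \<phi> :: "real \<Rightarrow> 'b::real_normed_vector"
  assumes "\<And>t. f t = f s + (t - s) *\<^sub>R \<phi> t" and "isCont \<phi> s"
  shows "(f has_vector_derivative \<phi> s) (at s)"
proof -
  have "(\<lambda>t. norm (\<phi> t - \<phi> s)) \<midarrow>s\<rightarrow> 0"
    using assms(2) by (simp add: isCont_def LIM_zero tendsto_norm_zero)
  moreover have "norm (\<phi> t - \<phi> s) = norm (f t - f s - (t - s) *\<^sub>R \<phi> s) / norm (t - s)"
    if "t \<noteq> s" for t
  proof -
    have "f t - f s - (t - s) *\<^sub>R \<phi> s = (t - s) *\<^sub>R (\<phi> t - \<phi> s)"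
      using assms(1)[of t] by (simp add: scaleR_diff_right)
    then show ?thesis using that by simp
  qed
  ultimately have "(\<lambda>t. norm (f t - f s - (t - s) *\<^sub>R \<phi> s) / norm (t - s)) \<midarrow>s\<rightarrow> 0"
    by (subst (asm) LIM_equal) auto
  then show ?thesis
    unfolding has_vector_derivative_def has_derivative_iff_norm
    by (simp add: bounded_linear_scaleR_left)
qed

lemma sum_norm_cauchy:
  "cmod (\<Sum>i\<in>I. a i * b i) \<le> sqrt (\<Sum>i\<in>I. (cmod (a i))\<^sup>2) * sqrt (\<Sum>i\<in>I. (cmod (b i))\<^sup>2)"
proof -
  have "cmod (\<Sum>i\<in>I. a i * b i) \<le> (\<Sum>i\<in>I. \<bar>cmod (a i)\<bar> * \<bar>cmod (b i)\<bar>)"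
    by (intro order_trans[OF norm_sum] sum_mono) (simp add: norm_mult)
  also have "\<dots> \<le> L2_set (\<lambda>i. cmod (a i)) I * L2_set (\<lambda>i. cmod (b i)) I"
    by (rule L2_set_mult_ineq)
  finally show ?thesis by (simp add: L2_set_def)
qed

locale resolvent =
  fixes m N :: nat and z :: complex
  assumes N_pos: "0 < N" and Im_z: "0 < Im z"
begin

text \<open>The array is a single function on pairs, hence a point of a product space, and varying
  one entry is a function update.\<close>

definition h :: "(nat \<times> nat \<Rightarrow> real) \<Rightarrow> nat \<Rightarrow> nat \<Rightarrow> complex" where
  "h X i j = complex_of_real (1 / real N * (\<Sum>\<mu><m. X (\<mu>, i) * X (\<mu>, j)))"

definition G :: "(nat \<times> nat \<Rightarrow> real) \<Rightarrow> nat \<Rightarrow> nat \<Rightarrow> complex" where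
  "G X i j = G_mat (curry X) m N z $$ (i, j)"

text \<open>With \<open>\<Xi>\<close> the \<open>m \<times> N\<close> data matrix, \<open>W = \<Xi> G\<close> and \<open>V = \<Xi> G\<^sup>2\<close>.\<close>
definition W :: "(nat \<times> nat \<Rightarrow> real) \<Rightarrow> nat \<Rightarrow> nat \<Rightarrow> complex" where
  "W X \<mu> x = (\<Sum>y<N. X (\<mu>, y) * G X y x)"

definition V :: "(nat \<times> nat \<Rightarrow> real) \<Rightarrow> nat \<Rightarrow> nat \<Rightarrow> complex" where
  "V X \<mu> x = (\<Sum>y<N. W X \<mu> y * G X y x)"

definition g :: "(nat \<times> nat \<Rightarrow> real) \<Rightarrow> complex" where
  "g X = (\<Sum>x<N. G X x x) / N"

definition A :: "(nat \<times> nat \<Rightarrow> real) \<Rightarrow> complex mat" where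
  "A X = H_mat (curry X) m N - z \<cdot>\<^sub>m 1\<^sub>m N"

definition apply_A :: "(nat \<times> nat \<Rightarrow> real) \<Rightarrow> (nat \<Rightarrow> complex) \<Rightarrow> nat \<Rightarrow> complex" where
  "apply_A X v i = (\<Sum>j<N. h X i j * v j) - z * v i"

lemma A_carrier: "A X \<in> carrier_mat N N"
  unfolding A_def H_mat_def by (intro minus_carrier_mat) auto

lemma A_entry: "i < N \<Longrightarrow> j < N \<Longrightarrow> A X $$ (i, j) = h X i j - (if i = j then z else 0)"
  by (simp add: A_def H_mat_def h_def)

lemma h_sym: "h X i j = h X j i"
  by (simp add: h_def mult.commute)

text \<open>H is a Gram matrix, so its contribution to the form is real and nonnegative, and the
  imaginary part comes from \<open>z\<close> alone. The norm bound, invertibility and the trace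
  identity all start here.\<close>

lemma quadratic_form:
  "(\<Sum>i<N. cnj (v i) * apply_A X v i) =
     complex_of_real ((\<Sum>\<mu><m. (cmod (\<Sum>y<N. X (\<mu>, y) * v y))\<^sup>2) / N)
     - z * complex_of_real (\<Sum>i<N. (cmod (v i))\<^sup>2)"
proof -
  have sq: "complex_of_real ((cmod w)\<^sup>2) = cnj w * w" for w
    by (metis complex_norm_square mult.commute)
  have "(\<Sum>i<N. cnj (v i) * (\<Sum>j<N. h X i j * v j)) =
     (\<Sum>i<N. \<Sum>j<N. \<Sum>\<mu><m. (1 / N) * (cnj (X (\<mu>, i) * v i) * (X (\<mu>, j) * v j)))"
    by (intro sum.cong refl)
      (simp add: h_def sum_distrib_left sum_distrib_right algebra_simps divide_inverse)
  also have "\<dots> = (\<Sum>\<mu><m. \<Sum>i<N. \<Sum>j<N. (1 / N) * (cnj (X (\<mu>, i) * v i) * (X (\<mu>, j) * v j)))"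
    by (rule trans[OF sum.cong[OF refl sum.swap] sum.swap])
  also have "\<dots> = (\<Sum>\<mu><m. (1 / N) * (cnj (\<Sum>y<N. X (\<mu>, y) * v y) * (\<Sum>y<N. X (\<mu>, y) * v y)))"
    unfolding cnj_sum sum_product by (simp only: sum_distrib_left)
  also have "\<dots> = complex_of_real ((\<Sum>\<mu><m. (cmod (\<Sum>y<N. X (\<mu>, y) * v y))\<^sup>2) / N)"
    unfolding of_real_divide of_real_sum sq by (simp add: sum_divide_distrib)
  finally have 1: "(\<Sum>i<N. cnj (v i) * (\<Sum>j<N. h X i j * v j)) = \<dots>" .
  have "(\<Sum>i<N. cnj (v i) * (z * v i)) = z * complex_of_real (\<Sum>i<N. (cmod (v i))\<^sup>2)"
    unfolding of_real_sum sq sum_distrib_left by (simp add: algebra_simps)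
  then show ?thesis using 1
    by (simp add: apply_A_def right_diff_distrib sum_subtractf)
qed

text \<open>The imaginary part of the form is \<open>- Im z\<close> times the squared norm of
  \<open>v\<close>, while Cauchy-Schwarz bounds the form by the product of the norms of
  \<open>v\<close> and \<open>apply_A X v\<close>. Stated without an inverse, the estimate can also
  prove that the inverse exists.\<close>

lemma inverse_bound:
  "sqrt (\<Sum>i<N. (cmod (v i))\<^sup>2) \<le> sqrt (\<Sum>i<N. (cmod (apply_A X v i))\<^sup>2) / Im z"
proof -
  define a where "a = sqrt (\<Sum>i<N. (cmod (v i))\<^sup>2)"
  define b where "b = sqrt (\<Sum>i<N. (cmod (apply_A X v i))\<^sup>2)"
  have a0: "a \<ge> 0" and b0: "b \<ge> 0" by (simp_all add: a_def b_def sum_nonneg)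
  have a2: "(\<Sum>i<N. (cmod (v i))\<^sup>2) = a\<^sup>2" by (simp add: a_def sum_nonneg)
  have "Im z * a\<^sup>2 = - Im (\<Sum>i<N. cnj (v i) * apply_A X v i)"
    unfolding quadratic_form a2 by simp
  also have "\<dots> \<le> cmod (\<Sum>i<N. cnj (v i) * apply_A X v i)"
    using abs_Im_le_cmod[of "\<Sum>i<N. cnj (v i) * apply_A X v i"] by linarith
  also have "\<dots> \<le> a * b"
    using sum_norm_cauchy[of "\<lambda>i. cnj (v i)" "apply_A X v" "{..<N}"] by (simp add: a_def b_def)
  finally have "a * (Im z * a) \<le> a * b" by (simp add: power2_eq_square algebra_simps)
  then have "Im z * a \<le> b" using a0 b0 by (cases "a = 0") auto
  then show ?thesis using Im_z unfolding a_def[symmetric] b_def[symmetric]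
    by (simp add: field_simps)
qed

lemma apply_A_mat:
  assumes "v \<in> carrier_vec N" "i < N"
  shows "(A X *\<^sub>v v) $ i = apply_A X (\<lambda>j. v $ j) i"
proof -
  have "(A X *\<^sub>v v) $ i = (\<Sum>j<N. (h X i j - (if i = j then z else 0)) * v $ j)"
    using assms A_carrier[of X]
    by (auto simp: scalar_prod_def A_entry atLeast0LessThan intro!: sum.cong)
  also have "\<dots> = (\<Sum>j<N. h X i j * v $ j) - (\<Sum>j<N. if i = j then z * v $ j else 0)"
    by (subst sum_subtractf[symmetric]) (auto intro!: sum.cong simp: algebra_simps)
  finally show ?thesis using assms(2) by (simp add: apply_A_def)
qed

lemma det_A: "Determinant.det (A X) \<noteq> 0"
proof
  assume "Determinant.det (A X) = 0"
  then obtain v where v: "v \<in> carrier_vec N" "v \<noteq> 0\<^sub>v N" "A X *\<^sub>v v = 0\<^sub>v N"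
    using det_0_iff_vec_prod_zero_field[OF A_carrier] by blast
  have "apply_A X (\<lambda>j. v $ j) i = 0" if "i < N" for i
    using apply_A_mat[OF v(1) that, of X] v(3) that by simp
  then have "sqrt (\<Sum>i<N. (cmod (v $ i))\<^sup>2) \<le> 0"
    using inverse_bound[of "\<lambda>j. v $ j" X] by simp
  then have "(\<Sum>i<N. (cmod (v $ i))\<^sup>2) = 0"
    by (simp add: order_antisym sum_nonneg)
  then have "v $ i = 0" if "i < N" for i
    using that by (subst (asm) sum_nonneg_eq_0_iff) auto
  then have "v = 0\<^sub>v N" using v(1) by (intro eq_vecI) auto
  with v(2) show False by simp
qed

lemma G_mat_inverse:
  "A X * G_mat (curry X) m N z = 1\<^sub>m N" "G_mat (curry X) m N z * A X = 1\<^sub>m N"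
  "G_mat (curry X) m N z \<in> carrier_mat N N"
proof -
  have "A X \<in> Units (ring_mat TYPE(complex) N ())"
    by (rule det_non_zero_imp_unit[OF A_carrier det_A])
  then obtain B where "mat_inverse (A X) = Some B"
    using mat_inverse(1)[OF A_carrier] by (metis not_None_eq)
  then show "A X * G_mat (curry X) m N z = 1\<^sub>m N" "G_mat (curry X) m N z * A X = 1\<^sub>m N"
    "G_mat (curry X) m N z \<in> carrier_mat N N"
    using mat_inverse(2)[OF A_carrier, of X B] by (auto simp: G_mat_def A_def[symmetric])
qed

text \<open>Cramer's rule. It displays each entry as a quotient of polynomials in the array, from
  which measurability of \<open>G\<close> is derived.\<close>

lemma G_cofactor:
  assumes "i < N" "j < N"
  shows "G X i j = adj_mat (A X) $$ (i, j) / Determinant.det (A X)"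
proof -
  let ?G = "G_mat (curry X) m N z"
  note [simp] = G_mat_inverse(3)[of X] A_carrier[of X] adj_mat(1)[OF A_carrier[of X]]
  have "adj_mat (A X) = adj_mat (A X) * (A X * ?G)"
    by (simp add: G_mat_inverse(1) right_mult_one_mat[of _ N N])
  also have "\<dots> = (adj_mat (A X) * A X) * ?G"
    by (rule assoc_mult_mat[symmetric, of _ N N _ N _ N]) auto
  also have "\<dots> = Determinant.det (A X) \<cdot>\<^sub>m ?G"
    by (simp add: adj_mat(3)[OF A_carrier] left_mult_one_mat[of _ N N]
        mult_smult_assoc_mat[of _ N N _ N])
  finally have "adj_mat (A X) $$ (i, j) = Determinant.det (A X) * ?G $$ (i, j)"
    using assms G_mat_inverse(3)[of X] by (metis carrier_matD index_smult_mat(1))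
  then show ?thesis using det_A[of X] by (simp add: G_def)
qed

text \<open>\<open>A X\<close> is complex symmetric, so the transpose of its inverse is again a left
  inverse, and a left inverse coincides with the right one.\<close>

lemma G_sym:
  assumes "i < N" "j < N"
  shows "G X i j = G X j i"
proof -
  let ?G = "G_mat (curry X) m N z"
  note c[simp] = G_mat_inverse(3)[of X] A_carrier[of X]
  have AT: "transpose_mat (A X) = A X"
    by (intro eq_matI) (auto simp: A_entry h_sym[of X] carrier_matD[OF A_carrier])
  have "transpose_mat ?G * A X = transpose_mat (A X * ?G)"
    by (simp add: transpose_mult[of _ N N _ N] AT)
  then have 1: "transpose_mat ?G * A X = 1\<^sub>m N" by (simp add: G_mat_inverse(1))
  have "transpose_mat ?G = transpose_mat ?G * (A X * ?G)"
    by (simp add: G_mat_inverse(1) right_mult_one_mat[of _ N N])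
  also have "\<dots> = transpose_mat ?G * A X * ?G"
    by (rule assoc_mult_mat[symmetric, of _ N N _ N _ N]) auto
  also have "\<dots> = ?G" unfolding 1 by (simp add: left_mult_one_mat[of _ N N])
  finally have "transpose_mat ?G $$ (j, i) = ?G $$ (j, i)" by simp
  then show ?thesis using assms c(1) by (auto simp: G_def)
qed

lemma apply_A_G:
  assumes "i < N" "j < N"
  shows "apply_A X (\<lambda>k. G X k j) i = (if i = j then 1 else 0)"
proof -
  let ?v = "col (G_mat (curry X) m N z) j"
  have v: "?v \<in> carrier_vec N"
    by (intro carrier_vecI) (simp add: carrier_matD[OF G_mat_inverse(3)])
  have k: "?v $ k = G X k j" if "k < N" for k
    using that assms(2) G_mat_inverse(3)[of X] by (auto simp: G_def)
  have "(A X *\<^sub>v ?v) $ i = (A X * G_mat (curry X) m N z) $$ (i, j)"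
    using assms A_carrier[of X] G_mat_inverse(3)[of X] by (auto simp: times_mat_def)
  also have "\<dots> = (if i = j then 1 else 0)" using assms by (simp add: G_mat_inverse(1))
  finally have "apply_A X (\<lambda>k. ?v $ k) i = (if i = j then 1 else 0)"
    using apply_A_mat[OF v assms(1), of X] by simp
  moreover have "apply_A X (\<lambda>k. ?v $ k) i = apply_A X (\<lambda>k. G X k j) i"
    unfolding apply_A_def using k assms by (auto intro!: sum.cong)
  ultimately show ?thesis by simp
qed

lemma G_bound:
  assumes "i < N" "j < N"
  shows "cmod (G X i j) \<le> 1 / Im z"
proof -
  have "(\<Sum>k<N. (cmod (apply_A X (\<lambda>k. G X k j) k))\<^sup>2) = (\<Sum>k<N. if k = j then 1 else 0)"
    by (intro sum.cong) (auto simp: apply_A_G assms(2))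
  then have "sqrt (\<Sum>k<N. (cmod (G X k j))\<^sup>2) \<le> 1 / Im z"
    using inverse_bound[of "\<lambda>k. G X k j" X] assms(2) by simp
  moreover have "(cmod (G X i j))\<^sup>2 \<le> (\<Sum>k<N. (cmod (G X k j))\<^sup>2)"
    using assms(1) by (intro member_le_sum) auto
  then have "cmod (G X i j) \<le> sqrt (\<Sum>k<N. (cmod (G X k j))\<^sup>2)"
    by (rule real_le_rsqrt)
  ultimately show ?thesis by linarith
qed

section \<open>Dependence of the resolvent on one entry of the array\<close>

lemma G_diff:
  assumes "a < N" "b < N"
  shows "G X a b - G Y a b = (\<Sum>i<N. \<Sum>j<N. G X a i * (h Y i j - h X i j) * G Y j b)"
proof -
  \<comment> \<open>The claim is the resolvent identity G(X) - G(Y) = G(X) (H(Y) - H(X)) G(Y). Here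
    \<open>d\<close> is A(Y) G(Y) = 1 and \<open>d'\<close> is G(X) A(X) = 1, obtained by symmetry;
    inserting each into the other resolvent, the terms with \<open>z\<close> cancel.\<close>
  have d: "(if i = b then 1 else 0) = (\<Sum>j<N. h Y i j * G Y j b) - z * G Y i b" if "i < N" for i
    using apply_A_G[OF that assms(2), of Y] by (simp add: apply_A_def)
  have d': "(if j = a then 1 else 0) = (\<Sum>i<N. G X a i * h X i j) - z * G X a j" if "j < N" for j
  proof -
    have "(\<Sum>i<N. G X a i * h X i j) = (\<Sum>i<N. h X j i * G X i a)"
    proof (intro sum.cong refl)
      fix i assume "i \<in> {..<N}"
      then show "G X a i * h X i j = h X j i * G X i a"
        using G_sym[of a i X] h_sym[of X i j] assms(1) by (simp add: mult.commute)
    qed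
    then show ?thesis
      using apply_A_G[OF that assms(1), of X] G_sym[OF that assms(1), of X]
      by (simp add: apply_A_def)
  qed
  have "G X a b = (\<Sum>i<N. G X a i * (if i = b then 1 else 0))"
    using assms by (simp add: mult_delta_right)
  also have "\<dots> = (\<Sum>i<N. G X a i * ((\<Sum>j<N. h Y i j * G Y j b) - z * G Y i b))"
    using d by (intro sum.cong) auto
  also have "\<dots> = (\<Sum>i<N. \<Sum>j<N. G X a i * h Y i j * G Y j b) - (\<Sum>i<N. z * G X a i * G Y i b)"
    by (simp only: right_diff_distrib sum_subtractf sum_distrib_left mult.assoc mult.left_commute)
  finally have 1: "G X a b = \<dots>" .
  have "G Y a b = (\<Sum>j<N. (if j = a then 1 else 0) * G Y j b)"
    using assms by (simp add: mult_delta_left)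
  also have "\<dots> = (\<Sum>j<N. ((\<Sum>i<N. G X a i * h X i j) - z * G X a j) * G Y j b)"
    using d' by (intro sum.cong) auto
  also have "\<dots> = (\<Sum>j<N. \<Sum>i<N. G X a i * h X i j * G Y j b) - (\<Sum>i<N. z * G X a i * G Y i b)"
    by (simp only: left_diff_distrib sum_subtractf sum_distrib_right mult.assoc)
  also have "(\<Sum>j<N. \<Sum>i<N. G X a i * h X i j * G Y j b) = (\<Sum>i<N. \<Sum>j<N. G X a i * h X i j * G Y j b)"
    by (rule sum.swap)
  finally show ?thesis using 1
    by (simp add: right_diff_distrib left_diff_distrib sum_subtractf)
qed

text \<open>Only row and column \<open>x\<close> of H change. The factor
  \<open>t - X (\<mu>, x)\<close> comes out exactly; the last summand is the second-order part at
  the diagonal position, where t^2 - a^2 = (t - a)(2a + (t - a)).\<close>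

lemma h_update:
  assumes "\<mu> < m"
  shows "h (X((\<mu>, x) := t)) i j - h X i j = complex_of_real ((t - X (\<mu>, x)) *
    ((if i = x then X (\<mu>, j) else 0) + (if j = x then X (\<mu>, i) else 0)
     + (if i = x \<and> j = x then t - X (\<mu>, x) else 0)) / N)"
proof -
  let ?Y = "X((\<mu>, x) := t)"
  have "(\<Sum>\<nu><m. ?Y (\<nu>, i) * ?Y (\<nu>, j)) - (\<Sum>\<nu><m. X (\<nu>, i) * X (\<nu>, j)) =
    (\<Sum>\<nu><m. if \<nu> = \<mu> then ?Y (\<mu>, i) * ?Y (\<mu>, j) - X (\<mu>, i) * X (\<mu>, j) else 0)"
    by (subst sum_subtractf[symmetric]) (rule sum.cong; auto)
  also have "\<dots> = ?Y (\<mu>, i) * ?Y (\<mu>, j) - X (\<mu>, i) * X (\<mu>, j)"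
    using assms by simp
  also have "\<dots> = (t - X (\<mu>, x)) *
    ((if i = x then X (\<mu>, j) else 0) + (if j = x then X (\<mu>, i) else 0)
     + (if i = x \<and> j = x then t - X (\<mu>, x) else 0))"
    by (auto simp: algebra_simps)
  finally show ?thesis
    unfolding h_def of_real_diff[symmetric] using N_pos by (simp add: diff_divide_distrib[symmetric])
qed

text \<open>The entries of both resolvents in \<open>G_diff\<close> are at most
  \<open>1 / Im z\<close> whatever \<open>t\<close> is, so continuity of H carries over.\<close>

lemma G_update_continuous:
  assumes "\<mu> < m" "a < N" "b < N"
  shows "isCont (\<lambda>t. G (X((\<mu>, x) := t)) a b) (X (\<mu>, x))"
proof -
  define k where "k t = (\<Sum>i<N. \<Sum>j<N. 1 / Im z * cmod (h X i j - h (X((\<mu>, x) := t)) i j) * (1 / Im z))" for t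
  have k0: "k \<midarrow>X (\<mu>, x)\<rightarrow> 0"
  proof -
    have "k \<midarrow>X (\<mu>, x)\<rightarrow> (\<Sum>i<N. \<Sum>j<N. 1 / Im z * cmod (0 :: complex) * (1 / Im z))"
      unfolding k_def
    proof (intro tendsto_sum tendsto_mult tendsto_const tendsto_norm)
      fix i j
      have "(\<lambda>t. - (h (X((\<mu>, x) := t)) i j - h X i j)) \<midarrow>X (\<mu>, x)\<rightarrow> - (complex_of_real 0)"
        unfolding h_update[OF assms(1)]
        using N_pos by (intro tendsto_minus tendsto_of_real) (auto intro!: tendsto_eq_intros)
      then show "(\<lambda>t. h X i j - h (X((\<mu>, x) := t)) i j) \<midarrow>X (\<mu>, x)\<rightarrow> 0" by simp
    qed
    then show ?thesis by simp
  qed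
  have "cmod (G (X((\<mu>, x) := t)) a b - G X a b) \<le> k t" for t
    unfolding k_def G_diff[OF assms(2,3)]
  proof (intro order_trans[OF norm_sum] sum_mono)
    fix i j assume "i \<in> {..<N}" "j \<in> {..<N}"
    then show "cmod (G (X((\<mu>, x) := t)) a i * (h X i j - h (X((\<mu>, x) := t)) i j) * G X j b)
      \<le> 1 / Im z * cmod (h X i j - h (X((\<mu>, x) := t)) i j) * (1 / Im z)"
      unfolding norm_mult using Im_z assms by (intro mult_mono G_bound order_refl) auto
  qed
  then have "(\<lambda>t. G (X((\<mu>, x) := t)) a b - G X a b) \<midarrow>X (\<mu>, x)\<rightarrow> 0"
    by (intro Lim_null_comparison[OF _ k0]) auto
  then show ?thesis by (simp add: isCont_def LIM_zero_iff)
qed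

lemma W_alt: "x < N \<Longrightarrow> W X \<mu> x = (\<Sum>y<N. G X x y * X (\<mu>, y))"
  by (auto simp: W_def mult.commute intro!: sum.cong G_sym)

lemma G_deriv:
  assumes "\<mu> < m" "x < N" "a < N" "b < N"
  shows "((\<lambda>t. G (X((\<mu>, x) := t)) a b) has_vector_derivative
     - (G X a x * W X \<mu> b + W X \<mu> a * G X x b) / N) (at (X (\<mu>, x)))"
proof -
  \<comment> \<open>The exact difference quotient. The perturbed resolvent occurs in the left factor
    only; at \<open>t = X (\<mu>, x)\<close> it becomes the unperturbed one and the double sum
    collapses to row and column \<open>x\<close>.\<close>
  define \<phi> where "\<phi> t = (\<Sum>i<N. \<Sum>j<N. G (X((\<mu>, x) := t)) a i *
    - complex_of_real (((if i = x then X (\<mu>, j) else 0) + (if j = x then X (\<mu>, i) else 0)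
     + (if i = x \<and> j = x then t - X (\<mu>, x) else 0)) / N) * G X j b)" for t
  have eq: "G (X((\<mu>, x) := t)) a b = G (X((\<mu>, x) := X (\<mu>, x))) a b + (t - X (\<mu>, x)) *\<^sub>R \<phi> t" for t
  proof -
    have "G (X((\<mu>, x) := t)) a b - G X a b = (t - X (\<mu>, x)) *\<^sub>R \<phi> t"
      unfolding G_diff[OF assms(3,4)] \<phi>_def scaleR_sum_right
    proof (intro sum.cong refl)
      fix i j
      have "h X i j - h (X((\<mu>, x) := t)) i j = - (h (X((\<mu>, x) := t)) i j - h X i j)" by simp
      then show "G (X((\<mu>, x) := t)) a i * (h X i j - h (X((\<mu>, x) := t)) i j) * G X j b =
        (t - X (\<mu>, x)) *\<^sub>R (G (X((\<mu>, x) := t)) a i *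
        - complex_of_real (((if i = x then X (\<mu>, j) else 0) + (if j = x then X (\<mu>, i) else 0)
        + (if i = x \<and> j = x then t - X (\<mu>, x) else 0)) / N) * G X j b)"
        unfolding h_update[OF assms(1)] by (simp add: scaleR_conv_of_real)
    qed
    then show ?thesis by (simp add: algebra_simps)
  qed
  have cont: "isCont \<phi> (X (\<mu>, x))"
    unfolding \<phi>_def
    by (intro continuous_intros G_update_continuous assms) (auto simp: isCont_def intro!: tendsto_eq_intros)
  have "\<phi> (X (\<mu>, x)) = (\<Sum>i<N. \<Sum>j<N. - (1 / N) * ((if i = x then G X a x * (X (\<mu>, j) * G X j b) else 0)
      + (if j = x then (G X a i * X (\<mu>, i)) * G X x b else 0)))"
    unfolding \<phi>_def by (intro sum.cong refl) (auto simp: algebra_simps add_divide_distrib)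
  also have "\<dots> = - (1 / N) * ((\<Sum>i<N. if i = x then G X a x * (\<Sum>j<N. X (\<mu>, j) * G X j b) else 0)
      + (\<Sum>i<N. (G X a i * X (\<mu>, i)) * G X x b))"
    unfolding sum_distrib_left[symmetric] sum.distrib
    using assms(2) by (simp add: if_distrib[of "sum _"] sum_distrib_left cong: if_cong)
       (simp add: sum.If_cases sum_distrib_left if_distrib)
  also have "\<dots> = - (G X a x * W X \<mu> b + W X \<mu> a * G X x b) / N"
    using assms by (simp add: W_def[of X \<mu> b] W_alt[of a] sum_distrib_right[symmetric]
        add_divide_distrib diff_divide_distrib)
  finally show ?thesis using has_vector_derivative_caratheodory[OF eq cont] by simp
qed


lemma W_deriv:
  assumes "\<mu> < m" "x < N"
  shows "((\<lambda>t. W (X((\<mu>, x) := t)) \<mu> x) has_vector_derivative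
     G X x x - ((W X \<mu> x)\<^sup>2 + G X x x * (\<Sum>y<N. X (\<mu>, y) * W X \<mu> y)) / N) (at (X (\<mu>, x)))"
proof -
  have "((\<lambda>t. W (X((\<mu>, x) := t)) \<mu> x) has_vector_derivative
      (\<Sum>y<N. X (\<mu>, y) * (- (G X y x * W X \<mu> x + W X \<mu> y * G X x x) / N)
        + (if y = x then 1 else 0) * G X y x)) (at (X (\<mu>, x)))"
    unfolding W_def[of "X((\<mu>, x) := _)"]
  proof (rule has_vector_derivative_sum)
    fix y assume y: "y \<in> {..<N}"
    have 1: "((\<lambda>t. complex_of_real ((X((\<mu>, x) := t)) (\<mu>, y))) has_vector_derivative
      (if y = x then 1 else 0)) (at (X (\<mu>, x)))"
      by (auto intro!: derivative_eq_intros has_vector_derivative_of_real simp: has_real_derivative_iff_has_vector_derivative[symmetric])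
    show "((\<lambda>t. complex_of_real ((X((\<mu>, x) := t)) (\<mu>, y)) * G (X((\<mu>, x) := t)) y x) has_vector_derivative
      X (\<mu>, y) * (- (G X y x * W X \<mu> x + W X \<mu> y * G X x x) / N)
        + (if y = x then 1 else 0) * G X y x) (at (X (\<mu>, x)))"
      using has_vector_derivative_mult[OF 1 G_deriv[OF assms, of y x X]] y assms by simp
  qed
  also have "(\<Sum>y<N. X (\<mu>, y) * (- (G X y x * W X \<mu> x + W X \<mu> y * G X x x) / N)
        + (if y = x then 1 else 0) * G X y x) =
     G X x x + (\<Sum>y<N. - ((X (\<mu>, y) * G X y x) * W X \<mu> x + G X x x * (X (\<mu>, y) * W X \<mu> y)) / N)"
    using assms(2) by (simp add: sum.distrib mult_delta_left algebra_simps)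
  also have "(\<Sum>y<N. - ((X (\<mu>, y) * G X y x) * W X \<mu> x + G X x x * (X (\<mu>, y) * W X \<mu> y)) / N)
     = - ((W X \<mu> x)\<^sup>2 + G X x x * (\<Sum>y<N. X (\<mu>, y) * W X \<mu> y)) / N"
    by (simp only: sum_divide_distrib[symmetric] sum_negf sum.distrib sum_distrib_right[symmetric]
        sum_distrib_left[symmetric] W_def[symmetric] power2_eq_square)
  finally show ?thesis by (simp only: diff_conv_add_uminus minus_divide_left)
qed

text \<open>On the diagonal the two terms of \<open>G_deriv\<close> are equal by symmetry, hence the
  factor 2. Summing them multiplies \<open>W\<close> by one more resolvent, which is how
  \<open>V\<close> enters.\<close>

lemma g_deriv:
  assumes "\<mu> < m" "x < N"
  shows "((\<lambda>t. g (X((\<mu>, x) := t))) has_vector_derivative - 2 * V X \<mu> x / (real N)\<^sup>2) (at (X (\<mu>, x)))"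
proof -
  have "((\<lambda>t. g (X((\<mu>, x) := t))) has_vector_derivative
     (\<Sum>y<N. - (G X y x * W X \<mu> y + W X \<mu> y * G X x y) / N) / N) (at (X (\<mu>, x)))"
    unfolding g_def
    by (intro has_vector_derivative_divide has_vector_derivative_sum G_deriv assms) auto
  also have "(\<Sum>y<N. - (G X y x * W X \<mu> y + W X \<mu> y * G X x y) / N) / N =
     (\<Sum>y<N. - 2 * (W X \<mu> y * G X y x) / N) / N"
    using assms by (intro arg_cong2[where f="(/)"] sum.cong refl) (simp add: G_sym[of x])
  also have "\<dots> = - 2 * V X \<mu> x / (real N)\<^sup>2"
    by (simp add: V_def sum_distrib_left sum_divide_distrib power2_eq_square)
  finally show ?thesis .
qed

section \<open>Trace identities and error bounds\<close>

lemma sum_XW: "(\<Sum>\<mu><m. \<Sum>x<N. X (\<mu>, x) * W X \<mu> x) = (real N)\<^sup>2 * (1 + z * g X)"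
proof -
  have "(\<Sum>\<mu><m. \<Sum>x<N. X (\<mu>, x) * W X \<mu> x) = (\<Sum>\<mu><m. \<Sum>x<N. \<Sum>y<N. (X (\<mu>, x) * X (\<mu>, y)) * G X y x)"
    by (simp add: W_def sum_distrib_left mult.assoc)
  also have "\<dots> = (\<Sum>x<N. \<Sum>y<N. \<Sum>\<mu><m. (X (\<mu>, x) * X (\<mu>, y)) * G X y x)"
    by (rule trans[OF sum.cong[OF refl sum.swap] sum.swap, symmetric])
  also have "\<dots> = (\<Sum>x<N. \<Sum>y<N. real N * (h X x y * G X y x))"
    using N_pos by (simp add: h_def sum_distrib_right)
  \<comment> \<open>The diagonal of H G = 1 + z G, read off from \<open>apply_A_G\<close>.\<close>
  also have "\<dots> = (\<Sum>x<N. real N * (1 + z * G X x x))"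
    using apply_A_G[of x x X for x] by (intro sum.cong refl) (simp add: apply_A_def sum_distrib_left[symmetric] diff_eq_eq)
  also have "\<dots> = (real N)\<^sup>2 * (1 + z * g X)"
    using N_pos by (simp add: g_def sum.distrib sum_distrib_left[symmetric] power2_eq_square field_simps)
  finally show ?thesis .
qed

text \<open>The double sum of \<open>sum_XW\<close> reappears here, multiplied by Tr G / N; this
  product of traces is the source of the quadratic term of \<open>P\<close>. Only the sum of the
  squares of \<open>W\<close> is not a polynomial in \<open>g\<close>, and it becomes an error
  term.\<close>

lemma sum_dW:
  "(\<Sum>\<mu><m. \<Sum>x<N. G X x x - ((W X \<mu> x)\<^sup>2 + G X x x * (\<Sum>y<N. X (\<mu>, y) * W X \<mu> y)) / N)
   = (real N)\<^sup>2 * (m / N * g X - g X * (1 + z * g X)) - (\<Sum>\<mu><m. \<Sum>x<N. (W X \<mu> x)\<^sup>2) / N"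
proof -
  have t: "(\<Sum>x<N. G X x x) = N * g X" using N_pos by (simp add: g_def)
  have "(\<Sum>\<mu><m. \<Sum>x<N. G X x x - ((W X \<mu> x)\<^sup>2 + G X x x * (\<Sum>y<N. X (\<mu>, y) * W X \<mu> y)) / N)
    = (\<Sum>\<mu><m. (\<Sum>x<N. G X x x)) - (\<Sum>\<mu><m. \<Sum>x<N. (W X \<mu> x)\<^sup>2) / N
      - (\<Sum>x<N. G X x x) * (\<Sum>\<mu><m. \<Sum>y<N. X (\<mu>, y) * W X \<mu> y) / N"
    by (simp only: add_divide_distrib sum_subtractf sum.distrib sum_divide_distrib[symmetric]
        sum_distrib_left[symmetric] sum_distrib_right[symmetric] diff_diff_eq)
  also have "\<dots> = (real N)\<^sup>2 * (m / N * g X - g X * (1 + z * g X)) - (\<Sum>\<mu><m. \<Sum>x<N. (W X \<mu> x)\<^sup>2) / N"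
    unfolding t sum_XW using N_pos by (simp add: power2_eq_square field_simps)
  finally show ?thesis .
qed

text \<open>The trace of \<open>G\<^sup>* (H - z) G = G\<^sup>*\<close>; its imaginary part is the Ward identity.\<close>
lemma trace_identity:
  "complex_of_real ((\<Sum>x<N. \<Sum>\<mu><m. (cmod (W X \<mu> x))\<^sup>2) / N)
     - z * complex_of_real (\<Sum>x<N. \<Sum>i<N. (cmod (G X i x))\<^sup>2) = N * cnj (g X)"
proof -
  have "complex_of_real ((\<Sum>\<mu><m. (cmod (W X \<mu> x))\<^sup>2) / N)
     - z * complex_of_real (\<Sum>i<N. (cmod (G X i x))\<^sup>2) = cnj (G X x x)" if "x < N" for x
  proof -
    have "(\<Sum>i<N. cnj (G X i x) * apply_A X (\<lambda>i. G X i x) i) = (\<Sum>i<N. cnj (G X i x) * (if i = x then 1 else 0))"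
      using that by (intro sum.cong refl) (simp add: apply_A_G)
    then show ?thesis
      using that unfolding quadratic_form W_def by (simp add: mult_delta_right)
  qed
  then have "(\<Sum>x<N. complex_of_real ((\<Sum>\<mu><m. (cmod (W X \<mu> x))\<^sup>2) / N)
     - z * complex_of_real (\<Sum>i<N. (cmod (G X i x))\<^sup>2)) = (\<Sum>x<N. cnj (G X x x))"
    by (intro sum.cong) auto
  also have "\<dots> = N * cnj (g X)" using N_pos by (simp add: g_def)
  finally show ?thesis
    by (simp only: sum_subtractf sum_distrib_left[symmetric] of_real_sum[symmetric] sum_divide_distrib[symmetric])
qed

lemma Im_g_nonneg: "0 \<le> Im (g X)"
proof -
  have "Im z * (\<Sum>x<N. \<Sum>i<N. (cmod (G X i x))\<^sup>2) = N * Im (g X)"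
    using arg_cong[OF trace_identity[of X], of Im] by simp
  moreover have "0 \<le> Im z * (\<Sum>x<N. \<Sum>i<N. (cmod (G X i x))\<^sup>2)"
    using Im_z by (intro mult_nonneg_nonneg sum_nonneg) auto
  ultimately show ?thesis using N_pos by (simp add: zero_le_mult_iff)
qed

text \<open>The squared Hilbert-Schmidt norm of \<open>W\<close>, through which both kinds of error
  terms are bounded.\<close>

definition S :: "(nat \<times> nat \<Rightarrow> real) \<Rightarrow> real" where
  "S X = (\<Sum>\<mu><m. \<Sum>x<N. (cmod (W X \<mu> x))\<^sup>2)"

lemma S_nonneg: "0 \<le> S X"
  by (simp add: S_def sum_nonneg)

text \<open>The trace identity expresses \<open>S X / N\<close> through \<open>cnj (g X)\<close> and
  the squared Hilbert-Schmidt norm of \<open>G\<close>, and its imaginary part turns the latter into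
  \<open>N * Im (g X) / Im z\<close>. Thus \<open>S\<close> costs a single power of
  \<open>1 / Im z\<close>, where the norm bound on \<open>G\<close> would cost two.\<close>

lemma S_bound: "S X * Im z \<le> (real N)\<^sup>2 * (Im z + cmod z) * cmod (g X)"
proof -
  define T where "T = (\<Sum>x<N. \<Sum>i<N. (cmod (G X i x))\<^sup>2)"
  have T0: "T \<ge> 0" by (simp add: T_def sum_nonneg)
  have S: "S X = (\<Sum>x<N. \<Sum>\<mu><m. (cmod (W X \<mu> x))\<^sup>2)" unfolding S_def by (rule sum.swap)
  have id: "complex_of_real (S X / N) - z * complex_of_real T = N * cnj (g X)"
    using trace_identity[of X] by (simp add: S T_def)
  have T: "Im z * T = N * Im (g X)" using arg_cong[OF id, of Im] by simp
  have "complex_of_real (S X / N) = N * cnj (g X) + z * complex_of_real T"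
    using id by (simp add: algebra_simps)
  then have "cmod (complex_of_real (S X / N)) \<le> cmod (N * cnj (g X)) + cmod (z * complex_of_real T)"
    by (metis norm_triangle_ineq)
  then have "S X / N \<le> N * cmod (g X) + cmod z * T"
    using S_nonneg[of X] T0 by (simp add: norm_mult norm_divide)
  then have "S X / N * Im z \<le> (N * cmod (g X) + cmod z * T) * Im z"
    using Im_z by (intro mult_right_mono) auto
  also have "\<dots> = N * Im z * cmod (g X) + cmod z * (N * Im (g X))"
    using T by (simp add: algebra_simps)
  also have "\<dots> \<le> N * Im z * cmod (g X) + cmod z * (N * cmod (g X))"
    using abs_Im_le_cmod[of "g X"] by (intro add_left_mono mult_left_mono) auto
  finally show ?thesis using N_pos by (simp add: field_simps power2_eq_square)
qed

text \<open>By symmetry of \<open>G\<close>, applying \<open>A X\<close> to row \<open>\<mu>\<close>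
  of \<open>V\<close> returns row \<open>\<mu>\<close> of \<open>W\<close>, so
  \<open>inverse_bound\<close> applies.\<close>

lemma V_row_bound: "sqrt (\<Sum>x<N. (cmod (V X \<mu> x))\<^sup>2) \<le> sqrt (\<Sum>x<N. (cmod (W X \<mu> x))\<^sup>2) / Im z"
proof -
  have "apply_A X (V X \<mu>) x = W X \<mu> x" if "x < N" for x
  proof -
    have "apply_A X (V X \<mu>) x = (\<Sum>y<N. W X \<mu> y * apply_A X (\<lambda>k. G X k y) x)"
    proof -
      have V: "V X \<mu> j = (\<Sum>y<N. W X \<mu> y * G X j y)" if "j < N" for j
        using that unfolding V_def by (intro sum.cong refl) (simp add: G_sym)
      have "apply_A X (V X \<mu>) x = (\<Sum>j<N. \<Sum>y<N. h X x j * (W X \<mu> y * G X j y)) - (\<Sum>y<N. z * (W X \<mu> y * G X x y))"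
        using that by (simp add: apply_A_def V sum_distrib_left)
      also have "\<dots> = (\<Sum>y<N. \<Sum>j<N. h X x j * (W X \<mu> y * G X j y)) - (\<Sum>y<N. z * (W X \<mu> y * G X x y))"
        by (subst sum.swap) (rule refl)
      also have "\<dots> = (\<Sum>y<N. W X \<mu> y * apply_A X (\<lambda>k. G X k y) x)"
        unfolding apply_A_def by (simp only: sum_subtractf right_diff_distrib sum_distrib_left mult.left_commute)
      finally show ?thesis .
    qed
    also have "\<dots> = (\<Sum>y<N. W X \<mu> y * (if x = y then 1 else 0))"
      using that by (intro sum.cong refl) (simp add: apply_A_G)
    also have "\<dots> = W X \<mu> x" using that by (simp add: mult_delta_right)
    finally show ?thesis .
  qed
  then show ?thesis using inverse_bound[of "V X \<mu>" X] by simp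
qed

text \<open>\<open>V'\<close> stands for \<open>V\<close> or its conjugate; both occur because the
  test function contains \<open>P\<close> and its conjugate.\<close>

lemma sum_WV_bound:
  assumes "\<And>\<mu> x. cmod (V' \<mu> x) = cmod (V X \<mu> x)"
  shows "cmod (\<Sum>\<mu><m. \<Sum>x<N. W X \<mu> x * V' \<mu> x) \<le> S X / Im z"
proof -
  have "cmod (\<Sum>x<N. W X \<mu> x * V' \<mu> x) \<le> (\<Sum>x<N. (cmod (W X \<mu> x))\<^sup>2) / Im z" for \<mu>
  proof -
    let ?w = "sqrt (\<Sum>x<N. (cmod (W X \<mu> x))\<^sup>2)"
    have "cmod (\<Sum>x<N. W X \<mu> x * V' \<mu> x) \<le> ?w * sqrt (\<Sum>x<N. (cmod (V' \<mu> x))\<^sup>2)"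
      by (rule sum_norm_cauchy)
    also have "\<dots> \<le> ?w * (?w / Im z)"
      unfolding assms by (intro mult_left_mono V_row_bound) (simp add: sum_nonneg)
    also have "\<dots> = (\<Sum>x<N. (cmod (W X \<mu> x))\<^sup>2) / Im z"
      by (simp add: sum_nonneg)
    finally show ?thesis .
  qed
  then have "cmod (\<Sum>\<mu><m. \<Sum>x<N. W X \<mu> x * V' \<mu> x) \<le> (\<Sum>\<mu><m. (\<Sum>x<N. (cmod (W X \<mu> x))\<^sup>2) / Im z)"
    by (rule order_trans[OF norm_sum sum_mono])
  then show ?thesis
    unfolding S_def sum_divide_distrib[of _ "{..<m}"] .
qed

lemma sum_W2_bound: "cmod (\<Sum>\<mu><m. \<Sum>x<N. (W X \<mu> x)\<^sup>2) \<le> S X"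
  unfolding S_def
  by (intro order_trans[OF norm_sum] sum_mono) (simp add: norm_power)

lemma g_bound: "cmod (g X) \<le> 1 / Im z"
proof -
  have "cmod (\<Sum>x<N. G X x x) \<le> (\<Sum>x<N. 1 / Im z)"
    by (intro order_trans[OF norm_sum] sum_mono G_bound) auto
  then show ?thesis using N_pos by (simp add: g_def norm_divide field_simps)
qed

end

section \<open>Moments of the self-consistent polynomial\<close>

lemma borel_measurable_det:
  fixes B :: "'x \<Rightarrow> complex mat"
  assumes "\<And>x. B x \<in> carrier_mat n n"
    and "\<And>i j. i < n \<Longrightarrow> j < n \<Longrightarrow> (\<lambda>x. B x $$ (i, j)) \<in> borel_measurable M"
  shows "(\<lambda>x. Determinant.det (B x)) \<in> borel_measurable M"
  unfolding det_def'[OF assms(1)]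
  by (intro borel_measurable_sum borel_measurable_times borel_measurable_const borel_measurable_prod assms(2))
    (auto dest: permutes_in_image)

lemma cnj_measurable [measurable]: "f \<in> borel_measurable M \<Longrightarrow> (\<lambda>x. cnj (f x)) \<in> borel_measurable M"
  by (rule measurable_compose[of f M borel cnj borel])
    (auto intro!: borel_measurable_continuous_onI continuous_intros)

lemma has_vector_derivative_cnj:
  "(f has_vector_derivative f') F \<Longrightarrow> ((\<lambda>t. cnj (f t)) has_vector_derivative cnj f') F"
  by (rule bounded_linear.has_vector_derivative[OF bounded_linear_cnj])

lemma has_vector_derivative_power_complex:
  fixes f :: "real \<Rightarrow> complex"
  assumes "(f has_vector_derivative f') (at t)"
  shows "((\<lambda>t. f t ^ n) has_vector_derivative of_nat n * f t ^ (n - 1) * f') (at t)"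
proof -
  have "((\<lambda>w. w ^ n) has_field_derivative of_nat n * f t ^ (n - 1)) (at (f t))"
    by (auto intro!: derivative_eq_intros)
  from field_vector_diff_chain_at[OF assms this] show ?thesis
    by (simp add: o_def mult.commute)
qed

locale gaussian_resolvent = resolvent +
  fixes u :: real
  assumes u_pos: "u > 0"
begin

definition I :: "(nat \<times> nat) set" where "I = {..<m} \<times> {..<N}"

abbreviation \<Omega> :: "(nat \<times> nat \<Rightarrow> real) measure" where "\<Omega> \<equiv> PiM I (\<lambda>_. gauss u)"

section \<open>Measurability of the resolvent\<close>

lemma finite_I: "finite I"
  by (simp add: I_def)

lemma h_measurable: "i < N \<Longrightarrow> j < N \<Longrightarrow> (\<lambda>X. h X i j) \<in> borel_measurable (PiM I (\<lambda>_. borel))"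
  unfolding h_def
  by (intro measurable_compose[OF _ borel_measurable_of_real] borel_measurable_times
      borel_measurable_sum borel_measurable_const measurable_component_singleton) (auto simp: I_def)

lemma A_measurable:
  "i < N \<Longrightarrow> j < N \<Longrightarrow> (\<lambda>X. A X $$ (i, j)) \<in> borel_measurable (PiM I (\<lambda>_. borel))"
  using h_measurable by (simp add: A_entry)

lemma G_measurable [measurable]:
  assumes "i < N" "j < N"
  shows "(\<lambda>X. G X i j) \<in> borel_measurable (PiM I (\<lambda>_. borel))"
proof -
  have d: "(\<lambda>X. Determinant.det (A X)) \<in> borel_measurable (PiM I (\<lambda>_. borel))"
    by (rule borel_measurable_det[OF A_carrier A_measurable])
  have "(\<lambda>X. Determinant.det (mat_delete (A X) j i)) \<in> borel_measurable (PiM I (\<lambda>_. borel))"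
  proof (rule borel_measurable_det[where n = "N - 1"])
    show "mat_delete (A X) j i \<in> carrier_mat (N - 1) (N - 1)" for X
      using A_carrier[of X] by (rule mat_delete_carrier)
    fix a b assume ab: "a < N - 1" "b < N - 1"
    \<comment> \<open>Deletion shifts the later indices by one. Row \<open>j\<close> and column
      \<open>i\<close> are deleted, in this order, because the adjugate is the transposed cofactor
      matrix.\<close>
    have "mat_delete (A X) j i $$ (a, b) = A X $$ (if a < j then a else Suc a, if b < i then b else Suc b)" for X
      using ab by (simp add: mat_delete_def carrier_matD[OF A_carrier])
    then show "(\<lambda>X. mat_delete (A X) j i $$ (a, b)) \<in> borel_measurable (PiM I (\<lambda>_. borel))"
      using ab by (simp only:) (intro A_measurable; auto)
  qed
  then have "(\<lambda>X. (- 1) ^ (j + i) * Determinant.det (mat_delete (A X) j i) / Determinant.det (A X))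
      \<in> borel_measurable (PiM I (\<lambda>_. borel))"
    using d by measurable
  moreover have "G X i j = (- 1) ^ (j + i) * Determinant.det (mat_delete (A X) j i) / Determinant.det (A X)" for X
    using assms by (simp add: G_cofactor adj_mat_def cofactor_def carrier_matD[OF A_carrier])
  ultimately show ?thesis by simp
qed

lemma X_measurable: "\<mu> < m \<Longrightarrow> y < N \<Longrightarrow> (\<lambda>X. X (\<mu>, y)) \<in> borel_measurable (PiM I (\<lambda>_. borel))"
  by (rule measurable_component_singleton) (simp add: I_def)

lemma W_measurable: "\<mu> < m \<Longrightarrow> x < N \<Longrightarrow> (\<lambda>X. W X \<mu> x) \<in> borel_measurable (PiM I (\<lambda>_. borel))"
  unfolding W_def
  by (intro borel_measurable_sum borel_measurable_times G_measurable
      measurable_compose[OF _ borel_measurable_of_real] X_measurable) auto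

lemma V_measurable: "\<mu> < m \<Longrightarrow> x < N \<Longrightarrow> (\<lambda>X. V X \<mu> x) \<in> borel_measurable (PiM I (\<lambda>_. borel))"
  unfolding V_def by (intro borel_measurable_sum borel_measurable_times G_measurable W_measurable) auto

lemma g_measurable [measurable]: "g \<in> borel_measurable (PiM I (\<lambda>_. borel))"
  unfolding g_def[abs_def] by (intro borel_measurable_divide borel_measurable_sum) auto

definition \<beta> :: complex where "\<beta> = z + u\<^sup>2 * (1 - m / N)"

text \<open>\<open>P\<close> is the self-consistent polynomial evaluated at \<open>g\<close>: it vanishes at the Stieltjes transform of
  the Marchenko-Pastur law with ratio \<open>m / N\<close>.\<close>
definition P :: "(nat \<times> nat \<Rightarrow> real) \<Rightarrow> complex" where
  "P X = 1 + \<beta> * g X + u\<^sup>2 * z * (g X)\<^sup>2"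

definition P' :: "(nat \<times> nat \<Rightarrow> real) \<Rightarrow> complex" where
  "P' X = \<beta> + 2 * u\<^sup>2 * z * g X"

text \<open>\<open>P \<sqdot> Q k = \<bar>P\<bar>\<^bsup>2k + 2\<^esup>\<close>, so integrating by parts against \<open>Q\<close> yields even moments of \<open>P\<close>.\<close>
definition Q :: "nat \<Rightarrow> (nat \<times> nat \<Rightarrow> real) \<Rightarrow> complex" where
  "Q k X = P X ^ k * cnj (P X) ^ Suc k"

definition dg :: "(nat \<times> nat \<Rightarrow> real) \<Rightarrow> nat \<Rightarrow> nat \<Rightarrow> complex" where
  "dg X \<mu> x = - 2 * V X \<mu> x / (real N)\<^sup>2"

text \<open>A real entry moves \<open>P\<close> and its conjugate simultaneously, so the product
  rule gives two terms. For \<open>k = 0\<close> the truncated exponent \<open>k - 1\<close> is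
  harmless, since its term carries the factor \<open>k\<close>.\<close>

definition dQ :: "nat \<Rightarrow> (nat \<times> nat \<Rightarrow> real) \<Rightarrow> nat \<Rightarrow> nat \<Rightarrow> complex" where
  "dQ k X \<mu> x = of_nat k * P X ^ (k - 1) * cnj (P X) ^ Suc k * P' X * dg X \<mu> x
     + of_nat (Suc k) * P X ^ k * cnj (P X) ^ k * cnj (P' X) * cnj (dg X \<mu> x)"

definition dW :: "(nat \<times> nat \<Rightarrow> real) \<Rightarrow> nat \<Rightarrow> nat \<Rightarrow> complex" where
  "dW X \<mu> x = G X x x - ((W X \<mu> x)\<^sup>2 + G X x x * (\<Sum>y<N. X (\<mu>, y) * W X \<mu> y)) / N"

lemma P_measurable [measurable]: "P \<in> borel_measurable (PiM I (\<lambda>_. borel))"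
  unfolding P_def[abs_def] by measurable

lemma P'_measurable [measurable]: "P' \<in> borel_measurable (PiM I (\<lambda>_. borel))"
  unfolding P'_def[abs_def] by measurable

lemma Q_measurable [measurable]: "Q k \<in> borel_measurable (PiM I (\<lambda>_. borel))"
  unfolding Q_def[abs_def] by measurable

lemma dW_measurable: "\<mu> < m \<Longrightarrow> x < N \<Longrightarrow> (\<lambda>X. dW X \<mu> x) \<in> borel_measurable (PiM I (\<lambda>_. borel))"
  unfolding dW_def
  by (intro borel_measurable_diff borel_measurable_divide borel_measurable_add borel_measurable_power
      borel_measurable_sum borel_measurable_times G_measurable borel_measurable_const W_measurable
      measurable_compose[OF _ borel_measurable_of_real] X_measurable) auto

lemma dQ_measurable:
  assumes "\<mu> < m" "x < N"
  shows "(\<lambda>X. dQ k X \<mu> x) \<in> borel_measurable (PiM I (\<lambda>_. borel))"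
proof -
  note [measurable] = V_measurable[OF assms]
  show ?thesis unfolding dQ_def dg_def by measurable
qed

lemma P_deriv:
  assumes "\<mu> < m" "x < N"
  shows "((\<lambda>t. P (X((\<mu>, x) := t))) has_vector_derivative P' X * dg X \<mu> x) (at (X (\<mu>, x)))"
proof -
  have g: "((\<lambda>t. g (X((\<mu>, x) := t))) has_vector_derivative dg X \<mu> x) (at (X (\<mu>, x)))"
    using g_deriv[OF assms] by (simp add: dg_def)
  have "((\<lambda>w. 1 + \<beta> * w + u\<^sup>2 * z * w\<^sup>2) has_field_derivative P' X) (at (g (X((\<mu>, x) := X (\<mu>, x)))))"
    unfolding P'_def by (auto intro!: derivative_eq_intros)
  from field_vector_diff_chain_at[OF g this] show ?thesis
    by (simp only: o_def P_def fun_upd_triv mult.commute[of "P' X"])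
qed

lemma Q_deriv:
  assumes "\<mu> < m" "x < N"
  shows "((\<lambda>t. Q k (X((\<mu>, x) := t))) has_vector_derivative dQ k X \<mu> x) (at (X (\<mu>, x)))"
proof -
  note d = P_deriv[OF assms, of X]
  have "((\<lambda>t. P (X((\<mu>, x) := t)) ^ k * cnj (P (X((\<mu>, x) := t))) ^ Suc k) has_vector_derivative
    P X ^ k * (of_nat (Suc k) * cnj (P X) ^ (Suc k - 1) * cnj (P' X * dg X \<mu> x))
    + of_nat k * P X ^ (k - 1) * (P' X * dg X \<mu> x) * cnj (P X) ^ Suc k) (at (X (\<mu>, x)))"
    using has_vector_derivative_mult[OF has_vector_derivative_power_complex[OF d, of k]
        has_vector_derivative_power_complex[OF has_vector_derivative_cnj[OF d], of "Suc k"]]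
    by (simp del: power_Suc of_nat_Suc)
  then show ?thesis
    unfolding Q_def dQ_def by (simp add: algebra_simps del: of_nat_Suc)
qed

text \<open>The constant blows up as \<open>Im z\<close> tends to 0; it serves integrability only
  and does not enter the final moment bound.\<close>

lemma bounded_functions:
  obtains K where "K \<ge> 0" "\<And>X. cmod (P X) \<le> K" "\<And>X. cmod (P' X) \<le> K"
proof
  have z0: "0 < Im z" by (rule Im_z)
  show "0 \<le> 1 + cmod \<beta> * (1 / Im z) + u\<^sup>2 * cmod z * (1 / Im z)\<^sup>2 + cmod \<beta> + 2 * u\<^sup>2 * cmod z * (1 / Im z)"
    using z0 by auto
  show "cmod (P X) \<le> 1 + cmod \<beta> * (1 / Im z) + u\<^sup>2 * cmod z * (1 / Im z)\<^sup>2 + cmod \<beta> + 2 * u\<^sup>2 * cmod z * (1 / Im z)" for X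
  proof -
    have "cmod (P X) \<le> cmod (1 :: complex) + cmod (\<beta> * g X) + cmod (u\<^sup>2 * z * (g X)\<^sup>2)"
      unfolding P_def by (intro norm_triangle_mono order_refl)
    also have "\<dots> = 1 + cmod \<beta> * cmod (g X) + u\<^sup>2 * cmod z * (cmod (g X))\<^sup>2"
      by (simp add: norm_mult norm_power)
    also have "\<dots> \<le> 1 + cmod \<beta> * (1 / Im z) + u\<^sup>2 * cmod z * (1 / Im z)\<^sup>2"
      by (intro add_mono mult_left_mono power_mono g_bound) auto
    finally show ?thesis using z0 by (auto intro: order_trans)
  qed
  show "cmod (P' X) \<le> 1 + cmod \<beta> * (1 / Im z) + u\<^sup>2 * cmod z * (1 / Im z)\<^sup>2 + cmod \<beta> + 2 * u\<^sup>2 * cmod z * (1 / Im z)" for X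
  proof -
    have "cmod (P' X) \<le> cmod \<beta> + cmod (2 * u\<^sup>2 * z * g X)"
      unfolding P'_def by (rule norm_triangle_ineq)
    also have "\<dots> = cmod \<beta> + 2 * u\<^sup>2 * cmod z * cmod (g X)"
      by (simp add: norm_mult norm_power)
    also have "\<dots> \<le> cmod \<beta> + 2 * u\<^sup>2 * cmod z * (1 / Im z)"
      by (intro add_mono mult_left_mono g_bound) auto
    finally show ?thesis using z0 by (auto intro: order_trans)
  qed
qed

text \<open>\<open>W\<close> and \<open>V\<close> grow at most linearly and \<open>dW\<close> at
  most quadratically in this l1 norm, which is the growth that
  \<open>PiM_gauss_integration_by_parts\<close> admits.\<close>

definition s :: "(nat \<times> nat \<Rightarrow> real) \<Rightarrow> real" where "s X = (\<Sum>j\<in>I. \<bar>X j\<bar>)"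

lemma s_nonneg: "0 \<le> s X"
  by (simp add: s_def sum_nonneg)

lemma sum_row_le: "\<mu> < m \<Longrightarrow> (\<Sum>y<N. \<bar>X (\<mu>, y)\<bar>) \<le> s X"
proof -
  assume "\<mu> < m"
  have "(\<Sum>y<N. \<bar>X (\<mu>, y)\<bar>) = (\<Sum>j\<in>Pair \<mu> ` {..<N}. \<bar>X j\<bar>)"
    by (subst sum.reindex) (auto simp: inj_on_def)
  also have "\<dots> \<le> s X" unfolding s_def
    using \<open>\<mu> < m\<close> finite_I by (intro sum_mono2) (auto simp: I_def)
  finally show ?thesis .
qed

lemma W_bound: "\<mu> < m \<Longrightarrow> x < N \<Longrightarrow> cmod (W X \<mu> x) \<le> s X / Im z"
proof -
  assume a: "\<mu> < m" "x < N"
  have "cmod (W X \<mu> x) \<le> (\<Sum>y<N. \<bar>X (\<mu>, y)\<bar> * (1 / Im z))"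
    unfolding W_def using a
    by (intro order_trans[OF norm_sum] sum_mono) (auto simp: norm_mult simp del: mult_1_right times_divide_eq_right intro!: mult_left_mono G_bound)
  also have "\<dots> \<le> s X * (1 / Im z)"
    unfolding sum_distrib_right[symmetric] using Im_z a by (intro mult_right_mono sum_row_le) auto
  finally show ?thesis by simp
qed

lemma V_bound: "\<mu> < m \<Longrightarrow> x < N \<Longrightarrow> cmod (V X \<mu> x) \<le> N * (s X / Im z * (1 / Im z))"
proof -
  assume a: "\<mu> < m" "x < N"
  have "cmod (V X \<mu> x) \<le> (\<Sum>y<N. s X / Im z * (1 / Im z))"
    unfolding V_def
  proof (intro order_trans[OF norm_sum] sum_mono)
    fix y assume "y \<in> {..<N}"
    then show "cmod (W X \<mu> y * G X y x) \<le> s X / Im z * (1 / Im z)"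
      unfolding norm_mult using a Im_z s_nonneg[of X] by (intro mult_mono W_bound G_bound) auto
  qed
  then show ?thesis by simp
qed

lemma s_square_le: "(s X)\<^sup>2 \<le> (card I)\<^sup>2 * quad_dom I X"
proof -
  have "(s X)\<^sup>2 = (\<Sum>i\<in>I. \<Sum>j\<in>I. \<bar>X i\<bar> * \<bar>X j\<bar>)"
    by (simp add: s_def power2_eq_square sum_product)
  also have "\<dots> \<le> (\<Sum>i\<in>I. \<Sum>j\<in>I. quad_dom I X)"
    by (intro sum_mono quad_dom_ge finite_I)
  finally show ?thesis by (simp add: power2_eq_square algebra_simps)
qed

lemma dW_bound: "\<mu> < m \<Longrightarrow> x < N \<Longrightarrow> cmod (dW X \<mu> x) \<le> 1 / Im z + 2 / (Im z)\<^sup>2 * (s X)\<^sup>2"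
proof -
  assume a: "\<mu> < m" "x < N"
  have 1: "cmod (\<Sum>y<N. X (\<mu>, y) * W X \<mu> y) \<le> s X * (s X / Im z)"
  proof -
    have "cmod (\<Sum>y<N. X (\<mu>, y) * W X \<mu> y) \<le> (\<Sum>y<N. \<bar>X (\<mu>, y)\<bar> * (s X / Im z))"
    proof (intro order_trans[OF norm_sum] sum_mono)
      fix y assume "y \<in> {..<N}"
      then show "cmod (X (\<mu>, y) * W X \<mu> y) \<le> \<bar>X (\<mu>, y)\<bar> * (s X / Im z)"
        unfolding norm_mult norm_of_real using a by (intro mult_left_mono W_bound) auto
    qed
    also have "\<dots> \<le> s X * (s X / Im z)"
      unfolding sum_distrib_right[symmetric] using Im_z a s_nonneg by (intro mult_right_mono sum_row_le) auto
    finally show ?thesis .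
  qed
  have "cmod (dW X \<mu> x) \<le> cmod (G X x x) + cmod ((W X \<mu> x)\<^sup>2 + G X x x * (\<Sum>y<N. X (\<mu>, y) * W X \<mu> y)) / N"
    unfolding dW_def by (rule order_trans[OF norm_triangle_ineq4]) (simp add: norm_divide)
  also have "\<dots> \<le> cmod (G X x x) + cmod ((W X \<mu> x)\<^sup>2 + G X x x * (\<Sum>y<N. X (\<mu>, y) * W X \<mu> y)) / 1"
    using N_pos by (intro add_left_mono divide_left_mono) auto
  also have "\<dots> \<le> 1 / Im z + (cmod (W X \<mu> x) ^ 2 + cmod (G X x x) * cmod (\<Sum>y<N. X (\<mu>, y) * W X \<mu> y))"
    using G_bound[OF a(2) a(2), of X] norm_triangle_ineq[of "(W X \<mu> x)\<^sup>2" "G X x x * (\<Sum>y<N. X (\<mu>, y) * W X \<mu> y)"]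
    by (simp add: norm_mult norm_power)
  also have "\<dots> \<le> 1 / Im z + ((s X / Im z) ^ 2 + 1 / Im z * (s X * (s X / Im z)))"
    using a Im_z s_nonneg[of X] by (intro add_left_mono add_mono power_mono mult_mono W_bound G_bound 1) auto
  also have "\<dots> = 1 / Im z + 2 / (Im z)\<^sup>2 * (s X)\<^sup>2"
    by (simp add: power2_eq_square field_simps)
  finally show ?thesis .
qed

lemma Q_bound: "cmod (Q k X) = cmod (P X) ^ (2 * k + 1)"
  by (simp add: Q_def norm_mult norm_power power_add[symmetric] mult_2)

lemma dQ_bound:
  "cmod (dQ k X \<mu> x) \<le> real (2 * k + 1) * cmod (P X) ^ (2 * k) * cmod (P' X) * cmod (dg X \<mu> x)"
proof -
  have 1: "real k * (cmod (P X) ^ (k - 1) * cmod (P X) ^ Suc k) = real k * cmod (P X) ^ (2 * k)"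
    by (cases k) (simp_all add: power_add[symmetric] mult_2)
  have "cmod (dQ k X \<mu> x) \<le> cmod (of_nat k * P X ^ (k - 1) * cnj (P X) ^ Suc k * P' X * dg X \<mu> x)
     + cmod (of_nat (Suc k) * P X ^ k * cnj (P X) ^ k * cnj (P' X) * cnj (dg X \<mu> x))"
    unfolding dQ_def by (rule norm_triangle_ineq)
  also have "\<dots> = (real k * (cmod (P X) ^ (k - 1) * cmod (P X) ^ Suc k)) * cmod (P' X) * cmod (dg X \<mu> x)
     + real (Suc k) * cmod (P X) ^ (2 * k) * cmod (P' X) * cmod (dg X \<mu> x)"
    by (simp add: norm_mult norm_power power_add mult_2 del: of_nat_Suc power_Suc)
  also have "\<dots> = real (2 * k + 1) * cmod (P X) ^ (2 * k) * cmod (P' X) * cmod (dg X \<mu> x)"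
    unfolding 1 by (simp add: algebra_simps)
  finally show ?thesis .
qed

lemma WQ_integration_by_parts:
  assumes a: "\<mu> < m" "x < N"
  shows "integrable \<Omega> (\<lambda>X. X (\<mu>, x) * (W X \<mu> x * Q k X))"
    and "integrable \<Omega> (\<lambda>X. dW X \<mu> x * Q k X + W X \<mu> x * dQ k X \<mu> x)"
    and "(\<integral>X. X (\<mu>, x) * (W X \<mu> x * Q k X) \<partial>\<Omega>)
       = u\<^sup>2 * (\<integral>X. dW X \<mu> x * Q k X + W X \<mu> x * dQ k X \<mu> x \<partial>\<Omega>)"
proof -
  obtain K where K: "K \<ge> 0" "\<And>X. cmod (P X) \<le> K" "\<And>X. cmod (P' X) \<le> K"
    using bounded_functions by blast
  have i: "(\<mu>, x) \<in> I" using a by (simp add: I_def)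
  have Im0: "Im z \<ge> 0" using Im_z by simp
  note s0 = s_nonneg
  \<comment> \<open>\<open>C1\<close> bounds the linear growth of the product of \<open>W\<close>
    and \<open>Q\<close>, \<open>c\<close> that of \<open>dQ\<close>, and \<open>C2\<close> the
    quadratic growth of the derivative of the product. The sum \<open>C1 + C2\<close> meets both
    growth hypotheses with one constant.\<close>
  define C1 where "C1 = 1 / Im z * K ^ (2 * k + 1)"
  define c where "c = real (2 * k + 1) * K ^ (2 * k) * K * (2 * (N * (1 / Im z * (1 / Im z))) / (real N)\<^sup>2)"
  define C2 where "C2 = (1 / Im z + 2 / (Im z)\<^sup>2 * (card I)\<^sup>2) * K ^ (2 * k + 1) + 1 / Im z * c * (card I)\<^sup>2"
  have c0: "c \<ge> 0" unfolding c_def using K(1) Im0 by (intro mult_nonneg_nonneg divide_nonneg_nonneg) auto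
  have C1: "C1 \<ge> 0" unfolding C1_def using K(1) Im0 by (intro mult_nonneg_nonneg) auto
  have C2: "C2 \<ge> 0" unfolding C2_def using K(1) Im0 c0
    by (intro add_nonneg_nonneg mult_nonneg_nonneg) auto
  have Q: "cmod (Q k X) \<le> K ^ (2 * k + 1)" for X
    unfolding Q_bound using K by (intro power_mono) auto
  have b1: "cmod (W X \<mu> x * Q k X) \<le> (C1 + C2) * (1 + (\<Sum>j\<in>I. \<bar>X j\<bar>))" for X
  proof -
    have "cmod (W X \<mu> x * Q k X) \<le> s X / Im z * K ^ (2 * k + 1)"
      unfolding norm_mult using a Im0 s0[of X] by (intro mult_mono W_bound Q) auto
    also have "\<dots> = C1 * s X" by (simp add: C1_def)
    also have "\<dots> \<le> (C1 + C2) * (1 + s X)" using C1 C2 s0[of X] by (intro mult_mono) auto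
    finally show ?thesis by (simp add: s_def)
  qed
  have b2: "cmod (dW X \<mu> x * Q k X + W X \<mu> x * dQ k X \<mu> x) \<le> (C1 + C2) * quad_dom I X" for X
  proof -
    have q1: "1 \<le> quad_dom I X" by (rule quad_dom_ge(1)[OF finite_I i i])
    have dQ: "cmod (dQ k X \<mu> x) \<le> c * s X"
    proof -
      have "cmod (dg X \<mu> x) = 2 * cmod (V X \<mu> x) / (real N)\<^sup>2"
        by (simp add: dg_def norm_mult norm_divide norm_power)
      also have "\<dots> \<le> 2 * (N * (s X / Im z * (1 / Im z))) / (real N)\<^sup>2"
        using a by (intro divide_right_mono mult_left_mono V_bound) auto
      finally have dg: "cmod (dg X \<mu> x) \<le> 2 * (N * (s X / Im z * (1 / Im z))) / (real N)\<^sup>2" .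
      have "cmod (dQ k X \<mu> x) \<le> real (2 * k + 1) * K ^ (2 * k) * K * (2 * (N * (s X / Im z * (1 / Im z))) / (real N)\<^sup>2)"
        by (rule order_trans[OF dQ_bound]) (use K in \<open>intro mult_mono power_mono dg; auto\<close>)
      also have "\<dots> = c * s X" by (simp add: c_def)
      finally show ?thesis .
    qed
    have "cmod (dW X \<mu> x * Q k X + W X \<mu> x * dQ k X \<mu> x)
      \<le> cmod (dW X \<mu> x) * cmod (Q k X) + cmod (W X \<mu> x) * cmod (dQ k X \<mu> x)"
      unfolding norm_mult[symmetric] by (rule norm_triangle_ineq)
    also have "\<dots> \<le> (1 / Im z + 2 / (Im z)\<^sup>2 * (s X)\<^sup>2) * K ^ (2 * k + 1) + (s X / Im z) * (c * s X)"
      using a Im0 s0[of X] by (intro add_mono mult_mono dW_bound Q W_bound dQ) auto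
    also have "\<dots> = (1 / Im z + 2 / (Im z)\<^sup>2 * (s X)\<^sup>2) * K ^ (2 * k + 1) + 1 / Im z * c * (s X)\<^sup>2"
      by (simp add: power2_eq_square)
    also have "\<dots> \<le> (1 / Im z * quad_dom I X + 2 / (Im z)\<^sup>2 * ((card I)\<^sup>2 * quad_dom I X)) * K ^ (2 * k + 1)
       + 1 / Im z * c * ((card I)\<^sup>2 * quad_dom I X)"
    proof -
      have "1 / Im z * 1 \<le> 1 / Im z * quad_dom I X" using q1 Im0 by (intro mult_left_mono) auto
      then show ?thesis
        using K(1) Im0 c0 by (intro add_mono mult_right_mono mult_left_mono s_square_le) auto
    qed
    also have "\<dots> = C2 * quad_dom I X" by (simp add: C2_def algebra_simps)
    also have "\<dots> \<le> (C1 + C2) * quad_dom I X" using C1 q1 by (intro mult_right_mono) auto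
    finally show ?thesis .
  qed
  have d: "((\<lambda>t. W (X((\<mu>, x) := t)) \<mu> x * Q k (X((\<mu>, x) := t))) has_vector_derivative
     dW X \<mu> x * Q k X + W X \<mu> x * dQ k X \<mu> x) (at (X (\<mu>, x)))" for X
    using has_vector_derivative_mult[OF W_deriv[OF a, of X] Q_deriv[OF a, of k X]]
    by (simp add: dW_def add.commute)
  have [measurable]: "(\<lambda>X. W X \<mu> x) \<in> borel_measurable (PiM I (\<lambda>_. borel))"
    "(\<lambda>X. dW X \<mu> x) \<in> borel_measurable (PiM I (\<lambda>_. borel))"
    "(\<lambda>X. dQ k X \<mu> x) \<in> borel_measurable (PiM I (\<lambda>_. borel))"
    using a by (auto intro: W_measurable dW_measurable dQ_measurable)
  have m: "(\<lambda>X. W X \<mu> x * Q k X) \<in> borel_measurable (PiM I (\<lambda>_. borel))"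
    "(\<lambda>X. dW X \<mu> x * Q k X + W X \<mu> x * dQ k X \<mu> x) \<in> borel_measurable (PiM I (\<lambda>_. borel))"
    by measurable
  note ibp = PiM_gauss_integration_by_parts[OF u_pos finite_I i d m b1 b2]
  show "integrable \<Omega> (\<lambda>X. X (\<mu>, x) * (W X \<mu> x * Q k X))" by (rule ibp(1))
  show "integrable \<Omega> (\<lambda>X. dW X \<mu> x * Q k X + W X \<mu> x * dQ k X \<mu> x)" by (rule ibp(2))
  show "(\<integral>X. X (\<mu>, x) * (W X \<mu> x * Q k X) \<partial>\<Omega>)
       = u\<^sup>2 * (\<integral>X. dW X \<mu> x * Q k X + W X \<mu> x * dQ k X \<mu> x \<partial>\<Omega>)"
    using ibp(3) by simp
qed

text \<open>What integration by parts leaves once the leading terms are collected into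
  \<open>P\<close>: the derivative falling on \<open>Q\<close>, and the squares of \<open>W\<close>
  from \<open>sum_dW\<close>.\<close>

definition Err :: "nat \<Rightarrow> (nat \<times> nat \<Rightarrow> real) \<Rightarrow> complex" where
  "Err k X = (\<Sum>\<mu><m. \<Sum>x<N. W X \<mu> x * dQ k X \<mu> x) - (\<Sum>\<mu><m. \<Sum>x<N. (W X \<mu> x)\<^sup>2) / N * Q k X"

lemma prob_\<Omega>: "prob_space \<Omega>"
  by (intro prob_space_PiM prob_space_normal_density u_pos)

lemma sets_\<Omega>: "sets \<Omega> = sets (PiM I (\<lambda>_. borel))"
  by (intro sets_PiM_cong) auto

lemma bounded_integrable:
  fixes f :: "(nat \<times> nat \<Rightarrow> real) \<Rightarrow> 'b::{banach, second_countable_topology}"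
  assumes "f \<in> borel_measurable (PiM I (\<lambda>_. borel))" "\<And>X. norm (f X) \<le> B"
  shows "integrable \<Omega> f"
proof -
  interpret prob_space \<Omega> by (rule prob_\<Omega>)
  have "f \<in> borel_measurable \<Omega>" using assms(1) by (simp add: measurable_cong_sets[OF sets_\<Omega> refl])
  then show ?thesis using assms(2) by (intro integrable_const_bound[where B = B]) auto
qed

lemma P_power_integrable: "integrable \<Omega> (\<lambda>X. cmod (P X) ^ n)"
proof -
  obtain K where K: "K \<ge> 0" "\<And>X. cmod (P X) \<le> K" "\<And>X. cmod (P' X) \<le> K"
    using bounded_functions by blast
  show ?thesis
    by (rule bounded_integrable[where B = "K ^ n"]) (use K in \<open>auto intro!: power_mono\<close>)
qed

text \<open>Integration by parts is summed over all entries; \<open>sum_XW\<close> evaluates the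
  left side and \<open>sum_dW\<close> the right side. Their difference is N^2 times the product of
  \<open>P\<close> and \<open>Q\<close>, up to \<open>Err\<close>.\<close>

lemma P_moment_identity:
  "integrable \<Omega> (Err k)"
  "(real N)\<^sup>2 * complex_of_real (\<integral>X. cmod (P X) ^ (2 * k + 2) \<partial>\<Omega>) = u\<^sup>2 * (\<integral>X. Err k X \<partial>\<Omega>)"
proof -
  define F where "F X = (\<Sum>\<mu><m. \<Sum>x<N. X (\<mu>, x) * (W X \<mu> x * Q k X))" for X
  define F' where "F' X = (\<Sum>\<mu><m. \<Sum>x<N. dW X \<mu> x * Q k X + W X \<mu> x * dQ k X \<mu> x)" for X
  have iF: "integrable \<Omega> F" "integrable \<Omega> F'"
    unfolding F_def[abs_def] F'_def[abs_def]
    by (intro Bochner_Integration.integrable_sum WQ_integration_by_parts; simp)+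
  have "(\<integral>X. F X \<partial>\<Omega>) = (\<Sum>\<mu><m. \<Sum>x<N. (\<integral>X. X (\<mu>, x) * (W X \<mu> x * Q k X) \<partial>\<Omega>))"
    unfolding F_def using WQ_integration_by_parts(1)
    by (subst Bochner_Integration.integral_sum; auto intro!: sum.cong Bochner_Integration.integral_sum)
  also have "\<dots> = (\<Sum>\<mu><m. \<Sum>x<N. u\<^sup>2 * (\<integral>X. dW X \<mu> x * Q k X + W X \<mu> x * dQ k X \<mu> x \<partial>\<Omega>))"
    by (intro sum.cong refl WQ_integration_by_parts(3)) auto
  also have "\<dots> = u\<^sup>2 * (\<Sum>\<mu><m. \<Sum>x<N. (\<integral>X. dW X \<mu> x * Q k X + W X \<mu> x * dQ k X \<mu> x \<partial>\<Omega>))"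
    by (simp add: sum_distrib_left)
  also have "(\<Sum>\<mu><m. \<Sum>x<N. (\<integral>X. dW X \<mu> x * Q k X + W X \<mu> x * dQ k X \<mu> x \<partial>\<Omega>)) = (\<integral>X. F' X \<partial>\<Omega>)"
    unfolding F'_def using WQ_integration_by_parts(2)
    by (subst Bochner_Integration.integral_sum; auto intro!: sum.cong Bochner_Integration.integral_sum[symmetric])
  finally have eq: "(\<integral>X. F X \<partial>\<Omega>) = u\<^sup>2 * (\<integral>X. F' X \<partial>\<Omega>)" .
  have F: "F X = (real N)\<^sup>2 * (1 + z * g X) * Q k X" for X
    unfolding sum_XW[symmetric] F_def by (simp add: sum_distrib_right mult.assoc)
  have F': "F' X = (real N)\<^sup>2 * (m / N * g X - g X * (1 + z * g X)) * Q k X + Err k X" for X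
  proof -
    have "F' X = (\<Sum>\<mu><m. \<Sum>x<N. dW X \<mu> x) * Q k X + (\<Sum>\<mu><m. \<Sum>x<N. W X \<mu> x * dQ k X \<mu> x)"
      by (simp add: F'_def sum.distrib sum_distrib_right)
    then show ?thesis unfolding dW_def sum_dW Err_def by (simp add: algebra_simps)
  qed
  obtain K where K: "K \<ge> 0" "\<And>X. cmod (P X) \<le> K" "\<And>X. cmod (P' X) \<le> K"
    using bounded_functions by blast
  have iPQ: "integrable \<Omega> (\<lambda>X. P X * Q k X)"
  proof (rule bounded_integrable[where B = "K * K ^ (2 * k + 1)"])
    show "norm (P X * Q k X) \<le> K * K ^ (2 * k + 1)" for X
      unfolding norm_mult Q_bound using K by (intro mult_mono power_mono) auto
  qed measurable
  \<comment> \<open>Solving this pointwise identity for \<open>Err k\<close> shows its integrability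
    without any estimate, since all other terms are integrable.\<close>
  have Err: "u\<^sup>2 * Err k X = (real N)\<^sup>2 * (P X * Q k X) - (F X - u\<^sup>2 * F' X)" for X
    unfolding F F' P_def \<beta>_def by (simp add: algebra_simps power2_eq_square)
  have "integrable \<Omega> (\<lambda>X. 1 / complex_of_real (u\<^sup>2) * ((real N)\<^sup>2 * (P X * Q k X) - (F X - u\<^sup>2 * F' X)))"
    using iPQ iF by (intro integrable_mult_right Bochner_Integration.integrable_diff) auto
  then show i: "integrable \<Omega> (Err k)"
    unfolding Err[symmetric] using u_pos by (simp add: field_simps)
  have "u\<^sup>2 * (\<integral>X. Err k X \<partial>\<Omega>) = (\<integral>X. u\<^sup>2 * Err k X \<partial>\<Omega>)"
    by simp
  also have "\<dots> = (real N)\<^sup>2 * (\<integral>X. P X * Q k X \<partial>\<Omega>) - ((\<integral>X. F X \<partial>\<Omega>) - u\<^sup>2 * (\<integral>X. F' X \<partial>\<Omega>))"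
    unfolding Err using iPQ iF by simp
  also have "\<dots> = (real N)\<^sup>2 * (\<integral>X. P X * Q k X \<partial>\<Omega>)" using eq by simp
  also have "(\<integral>X. P X * Q k X \<partial>\<Omega>) = (\<integral>X. complex_of_real (cmod (P X) ^ (2 * k + 2)) \<partial>\<Omega>)"
  proof (rule Bochner_Integration.integral_cong[OF refl])
    fix X
    have "P X * Q k X = (P X * cnj (P X)) ^ Suc k" by (simp add: Q_def power_mult_distrib mult_ac)
    also have "\<dots> = complex_of_real (cmod (P X) ^ (2 * k + 2))"
      unfolding complex_norm_square[symmetric] of_real_power[symmetric] power_mult[symmetric] by simp
    finally show "P X * Q k X = complex_of_real (cmod (P X) ^ (2 * k + 2))" .
  qed
  also have "\<dots> = complex_of_real (\<integral>X. cmod (P X) ^ (2 * k + 2) \<partial>\<Omega>)"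
    by (rule integral_complex_of_real)
  finally show "(real N)\<^sup>2 * complex_of_real (\<integral>X. cmod (P X) ^ (2 * k + 2) \<partial>\<Omega>) = u\<^sup>2 * (\<integral>X. Err k X \<partial>\<Omega>)"
    by simp
qed

lemma Err_bound:
  "cmod (Err k X) \<le> (real N)\<^sup>2 * (Im z + cmod z) * (1 / (N * Im z) * cmod (g X) * cmod (P X) ^ (2 * k + 1)
     + 2 * real (2 * k + 1) * (1 / (N * Im z))\<^sup>2 * cmod (g X) * cmod (P' X) * cmod (P X) ^ (2 * k))"
proof -
  have S: "S X \<le> (real N)\<^sup>2 * (Im z + cmod z) * cmod (g X) / Im z"
    using S_bound[of X] Im_z by (simp add: field_simps)
  \<comment> \<open>\<open>a\<close> and \<open>b\<close> are the coefficients of \<open>V\<close>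
    and its conjugate in \<open>dQ\<close>. They do not depend on the entry, and their weights
    \<open>k\<close> and \<open>Suc k\<close> add up to \<open>2 * k + 1\<close>.\<close>
  define a where "a = of_nat k * P X ^ (k - 1) * cnj (P X) ^ Suc k * P' X * (- 2 / (real N)\<^sup>2)"
  define b where "b = of_nat (Suc k) * P X ^ k * cnj (P X) ^ k * cnj (P' X) * (- 2 / (real N)\<^sup>2)"
  have "(\<Sum>\<mu><m. \<Sum>x<N. W X \<mu> x * dQ k X \<mu> x) = a * (\<Sum>\<mu><m. \<Sum>x<N. W X \<mu> x * V X \<mu> x)
     + b * (\<Sum>\<mu><m. \<Sum>x<N. W X \<mu> x * cnj (V X \<mu> x))"
    unfolding sum_distrib_left sum.distrib[symmetric]
    by (intro sum.cong refl) (simp add: dQ_def dg_def a_def b_def field_simps del: of_nat_Suc)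
  then have "cmod (\<Sum>\<mu><m. \<Sum>x<N. W X \<mu> x * dQ k X \<mu> x) \<le> cmod a * cmod (\<Sum>\<mu><m. \<Sum>x<N. W X \<mu> x * V X \<mu> x)
     + cmod b * cmod (\<Sum>\<mu><m. \<Sum>x<N. W X \<mu> x * cnj (V X \<mu> x))"
    unfolding norm_mult[symmetric] by (simp only: norm_triangle_ineq)
  also have "\<dots> \<le> cmod a * (S X / Im z) + cmod b * (S X / Im z)"
    by (intro add_mono mult_left_mono sum_WV_bound) auto
  also have "\<dots> = (cmod a + cmod b) * (S X / Im z)" by (simp add: distrib_right add_divide_distrib)
  also have "cmod a + cmod b = real (2 * k + 1) * cmod (P X) ^ (2 * k) * cmod (P' X) * (2 / (real N)\<^sup>2)"
  proof -
    have 1: "real k * (cmod (P X) ^ (k - 1) * cmod (P X) ^ Suc k) = real k * cmod (P X) ^ (2 * k)"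
      by (cases k) (simp_all add: power_add[symmetric] mult_2)
    have "cmod a = (real k * (cmod (P X) ^ (k - 1) * cmod (P X) ^ Suc k)) * cmod (P' X) * (2 / (real N)\<^sup>2)"
      unfolding a_def by (simp add: norm_mult norm_power norm_divide del: power_Suc)
    moreover have "cmod b = real (Suc k) * cmod (P X) ^ (2 * k) * cmod (P' X) * (2 / (real N)\<^sup>2)"
      unfolding b_def by (simp add: norm_mult norm_power norm_divide power_add[symmetric] mult_2 del: of_nat_Suc)
    ultimately show ?thesis unfolding 1 by (simp add: algebra_simps add_divide_distrib)
  qed
  finally have 1: "cmod (\<Sum>\<mu><m. \<Sum>x<N. W X \<mu> x * dQ k X \<mu> x) \<le>
     real (2 * k + 1) * cmod (P X) ^ (2 * k) * cmod (P' X) * (2 / (real N)\<^sup>2) * (S X / Im z)" .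
  have "cmod (Err k X) \<le> cmod (\<Sum>\<mu><m. \<Sum>x<N. W X \<mu> x * dQ k X \<mu> x)
     + cmod (\<Sum>\<mu><m. \<Sum>x<N. (W X \<mu> x)\<^sup>2) / N * cmod (P X) ^ (2 * k + 1)"
    unfolding Err_def by (rule order_trans[OF norm_triangle_ineq4]) (simp add: norm_mult norm_divide Q_bound)
  also have "\<dots> \<le> real (2 * k + 1) * cmod (P X) ^ (2 * k) * cmod (P' X) * (2 / (real N)\<^sup>2) * (S X / Im z)
     + S X / N * cmod (P X) ^ (2 * k + 1)"
    by (intro add_mono 1 mult_right_mono divide_right_mono sum_W2_bound) auto
  also have "\<dots> = S X * ((real (2 * k + 1) * cmod (P X) ^ (2 * k) * cmod (P' X) * (2 / (real N)\<^sup>2)) / Im z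
     + cmod (P X) ^ (2 * k + 1) / N)"
    by (simp add: algebra_simps add_divide_distrib)
  also have "\<dots> \<le> ((real N)\<^sup>2 * (Im z + cmod z) * cmod (g X) / Im z) *
     ((real (2 * k + 1) * cmod (P X) ^ (2 * k) * cmod (P' X) * (2 / (real N)\<^sup>2)) / Im z
     + cmod (P X) ^ (2 * k + 1) / N)"
    using Im_z by (intro mult_right_mono S) auto
  also have "\<dots> = (real N)\<^sup>2 * (Im z + cmod z) * (1 / (N * Im z) * cmod (g X) * cmod (P X) ^ (2 * k + 1)
     + 2 * real (2 * k + 1) * (1 / (N * Im z))\<^sup>2 * cmod (g X) * cmod (P' X) * cmod (P X) ^ (2 * k))"
    using N_pos Im_z by (simp add: power2_eq_square divide_simps) (simp add: algebra_simps)
  finally show ?thesis .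
qed

end

text \<open>Above the threshold \<open>L * \<epsilon>\<close> the left side is at most
  \<open>4 * K / L\<close> times \<open>a ^ (2 * k + 2)\<close>, and \<open>L \<ge> 8 * K\<close>
  makes that at most one half. Below it, \<open>a\<close> is replaced by
  \<open>L * \<epsilon>\<close>, and \<open>1 + a\<close> by 2, which leaves a pure power of
  \<open>\<epsilon>\<close>. The summand 1 in \<open>L\<close> ensures \<open>L \<ge> 1\<close> even
  for \<open>K = 0\<close>.\<close>

lemma young_absorb:
  fixes a \<epsilon> K L :: real
  assumes "0 \<le> a" "0 < \<epsilon>" "0 \<le> K" and L: "L = 8 * K + 1" and \<epsilon>: "L * \<epsilon> \<le> 1"
  shows "K * (\<epsilon> * (1 + a) * a ^ (2 * k + 1) + \<epsilon>\<^sup>2 * (1 + a) * a ^ (2 * k))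
    \<le> a ^ (2 * k + 2) / 2 + 2 * K * (L ^ (2 * k + 1) + L ^ (2 * k)) * \<epsilon> ^ (2 * k + 2)"
proof (cases "L * \<epsilon> \<le> a")
  case True
  have L1: "1 \<le> L" using assms by simp
  have "\<epsilon> \<le> a / L" using True L1 by (simp add: field_simps)
  moreover have "\<epsilon> * a \<le> a / L"
    using mult_right_mono[OF \<epsilon> assms(1)] L1 by (simp add: field_simps)
  moreover have "2 / L * a = a / L + a / L" by simp
  ultimately have 1: "\<epsilon> * (1 + a) \<le> 2 / L * a" unfolding distrib_left by linarith
  have 2: "\<epsilon> \<le> a"
    using True mult_right_mono[OF L1 less_imp_le[OF assms(2)]] by linarith
  have "\<epsilon> * (1 + a) * a ^ (2 * k + 1) + \<epsilon>\<^sup>2 * (1 + a) * a ^ (2 * k)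
      = \<epsilon> * (1 + a) * (a ^ (2 * k + 1) + \<epsilon> * a ^ (2 * k))"
    by (simp add: power2_eq_square algebra_simps)
  also have "\<dots> \<le> 2 / L * a * (a ^ (2 * k + 1) + a * a ^ (2 * k))"
    using assms L1 by (intro mult_mono add_left_mono mult_right_mono 1 2) auto
  also have "\<dots> = 4 / L * a ^ (2 * k + 2)" by (simp add: algebra_simps)
  finally have "K * (\<epsilon> * (1 + a) * a ^ (2 * k + 1) + \<epsilon>\<^sup>2 * (1 + a) * a ^ (2 * k)) \<le> K * (4 / L * a ^ (2 * k + 2))"
    using assms by (intro mult_left_mono) auto
  also have "\<dots> = 4 * K / L * a ^ (2 * k + 2)" by simp
  also have "\<dots> \<le> 1 / 2 * a ^ (2 * k + 2)"
    using assms L1 by (intro mult_right_mono) (auto simp: field_simps)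
  also have "\<dots> \<le> a ^ (2 * k + 2) / 2 + 2 * K * (L ^ (2 * k + 1) + L ^ (2 * k)) * \<epsilon> ^ (2 * k + 2)"
    using assms L1 by simp
  finally show ?thesis .
next
  case False
  then have a: "a \<le> L * \<epsilon>" "a \<le> 1" using \<epsilon> by linarith+
  have L1: "1 \<le> L" using assms by simp
  have "K * (\<epsilon> * (1 + a) * a ^ (2 * k + 1) + \<epsilon>\<^sup>2 * (1 + a) * a ^ (2 * k))
    \<le> K * (\<epsilon> * 2 * (L * \<epsilon>) ^ (2 * k + 1) + \<epsilon>\<^sup>2 * 2 * (L * \<epsilon>) ^ (2 * k))"
    using assms a by (intro mult_left_mono add_mono mult_mono power_mono) auto
  also have "\<dots> = 2 * K * (L ^ (2 * k + 1) + L ^ (2 * k)) * \<epsilon> ^ (2 * k + 2)"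
    by (simp add: power_mult_distrib power2_eq_square algebra_simps)
  also have "\<dots> \<le> a ^ (2 * k + 2) / 2 + 2 * K * (L ^ (2 * k + 1) + L ^ (2 * k)) * \<epsilon> ^ (2 * k + 2)"
    using assms by simp
  finally show ?thesis .
qed

section \<open>Closing the moment inequality\<close>

context gaussian_resolvent
begin

text \<open>The leading term of \<open>P\<close> controls \<open>g\<close>; this replaces any a priori bound on \<open>Im g\<close>, so no bootstrap
  in the imaginary part of \<open>z\<close> is required.\<close>
lemma g_square_bound:
  assumes b: "0 < b" "b \<le> u\<^sup>2 * cmod z" and B: "cmod \<beta> \<le> B"
  shows "(cmod (g X))\<^sup>2 \<le> (2 / b + (B / b)\<^sup>2) * (1 + cmod (P X))"
proof -
  define t where "t = cmod (g X)"
  have t0: "t \<ge> 0" by (simp add: t_def)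
  have "u\<^sup>2 * z * (g X)\<^sup>2 = P X - (1 + \<beta> * g X)" by (simp add: P_def)
  then have "cmod (u\<^sup>2 * z * (g X)\<^sup>2) \<le> cmod (P X) + cmod (1 + \<beta> * g X)"
    by (metis norm_triangle_ineq4)
  also have "cmod (1 + \<beta> * g X) \<le> 1 + cmod \<beta> * t"
    using norm_triangle_ineq[of 1 "\<beta> * g X"] by (simp add: norm_mult t_def)
  also have "\<dots> \<le> 1 + B * t" using B t0 by (intro add_left_mono mult_right_mono) auto
  finally have "u\<^sup>2 * cmod z * t\<^sup>2 \<le> cmod (P X) + 1 + B * t"
    by (simp add: norm_mult norm_power t_def)
  then have 1: "b * t\<^sup>2 \<le> cmod (P X) + 1 + B * t"
    using mult_right_mono[OF b(2), of "t\<^sup>2"] by simp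
  have "0 \<le> (b * t - B)\<^sup>2" by simp
  then have "2 * b * (B * t) \<le> b\<^sup>2 * t\<^sup>2 + B\<^sup>2" by (simp add: power2_eq_square algebra_simps)
  moreover have "2 * b * (b * t\<^sup>2) \<le> 2 * b * (cmod (P X) + 1 + B * t)"
    using b 1 by (intro mult_left_mono) auto
  ultimately have "b\<^sup>2 * t\<^sup>2 \<le> 2 * b * (1 + cmod (P X)) + B\<^sup>2"
    by (simp add: power2_eq_square algebra_simps)
  also have "\<dots> \<le> 2 * b * (1 + cmod (P X)) + B\<^sup>2 * (1 + cmod (P X))"
    by (simp add: algebra_simps)
  also have "\<dots> = b\<^sup>2 * ((2 / b + (B / b)\<^sup>2) * (1 + cmod (P X)))"
    using b by (simp add: power2_eq_square field_simps)
  finally show ?thesis using b by (simp add: t_def)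
qed

text \<open>The extra 1 in \<open>C\<close> makes it bound \<open>cmod (g X)\<close> as well as its
  square, through |g| \<le> 1 + |g|^2. In \<open>K\<close>, the factor 2 B bounds Im z + |z|, and 6
  (2k + 1) B is the 2 (2k + 1) of \<open>Err_bound\<close> times the 3 B from the bound 3 B C (1 +
  |P|) on |g P'(g)|. The condition \<open>L \<le> N * Im z\<close> is the smallness of
  \<open>\<epsilon>\<close> that \<open>young_absorb\<close> requires.\<close>

lemma moment_bound:
  assumes b: "0 < b" "b \<le> u\<^sup>2 * cmod z" and B: "cmod \<beta> \<le> B" "cmod z \<le> B" "u\<^sup>2 * cmod z \<le> B"
    and C: "C = 1 + (2 / b + (B / b)\<^sup>2)" and K: "K = 2 * u\<^sup>2 * B * C * (1 + 6 * real (2 * k + 1) * B)"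
    and L: "L = 8 * K + 1" "L \<le> N * Im z"
  shows "(\<integral>X. cmod (P X) ^ (2 * k + 2) \<partial>\<Omega>) \<le> 4 * K * (L ^ (2 * k + 1) + L ^ (2 * k)) * (1 / (N * Im z)) ^ (2 * k + 2)"
proof -
  interpret prob_space \<Omega> by (rule prob_\<Omega>)
  define \<epsilon> where "\<epsilon> = 1 / (N * Im z)"
  define D where "D = 2 * K * (L ^ (2 * k + 1) + L ^ (2 * k)) * \<epsilon> ^ (2 * k + 2)"
  have NI: "0 < N * Im z" using N_pos Im_z by simp
  have \<epsilon>: "0 < \<epsilon>" "L * \<epsilon> \<le> 1" using NI L(2) by (auto simp: \<epsilon>_def)
  have B0: "0 \<le> B" using B(1) norm_ge_zero order_trans by blast
  have C0: "1 \<le> C" using b B0 by (simp add: C)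
  have K0: "0 \<le> K" unfolding K using B0 C0 by (intro mult_nonneg_nonneg add_nonneg_nonneg) auto
  have key: "u\<^sup>2 / (real N)\<^sup>2 * cmod (Err k X) \<le> cmod (P X) ^ (2 * k + 2) / 2 + D" for X
  proof -
    define a where "a = cmod (P X)"
    have a0: "0 \<le> a" by (simp add: a_def)
    have g2: "(cmod (g X))\<^sup>2 \<le> C * (1 + a)"
    proof -
      have "C * (1 + a) = (1 + a) + (2 / b + (B / b)\<^sup>2) * (1 + a)" by (simp add: C distrib_right)
      then show ?thesis using g_square_bound[OF b B(1), of X, folded a_def] a0 by linarith
    qed
    have "cmod (g X) \<le> 1 + (2 / b + (B / b)\<^sup>2) * (1 + a)"
    proof -
      have "2 * cmod (g X) \<le> 1 + (cmod (g X))\<^sup>2" using sum_squares_bound[of 1 "cmod (g X)"] by simp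
      moreover have "0 \<le> (cmod (g X))\<^sup>2" by simp
      ultimately show ?thesis using g_square_bound[OF b B(1), of X] unfolding a_def by linarith
    qed
    also have "\<dots> \<le> C * (1 + a)" using a0 by (simp add: C algebra_simps)
    finally have g1: "cmod (g X) \<le> C * (1 + a)" .
    have "cmod (P' X) \<le> B + 2 * B * cmod (g X)"
    proof -
      have "cmod (P' X) \<le> cmod \<beta> + cmod (2 * u\<^sup>2 * z * g X)"
        unfolding P'_def by (rule norm_triangle_ineq)
      also have "\<dots> = cmod \<beta> + 2 * (u\<^sup>2 * cmod z) * cmod (g X)"
        by (simp add: norm_mult norm_power)
      also have "\<dots> \<le> B + 2 * B * cmod (g X)"
        using B by (intro add_mono mult_right_mono mult_left_mono) auto
      finally show ?thesis .
    qed
    then have "cmod (g X) * cmod (P' X) \<le> cmod (g X) * (B + 2 * B * cmod (g X))"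
      by (intro mult_left_mono) auto
    also have "\<dots> = B * cmod (g X) + 2 * B * (cmod (g X))\<^sup>2"
      by (simp add: power2_eq_square algebra_simps)
    also have "\<dots> \<le> B * (C * (1 + a)) + 2 * B * (C * (1 + a))"
      using B0 g1 g2 by (intro add_mono mult_left_mono) auto
    finally have gP: "cmod (g X) * cmod (P' X) \<le> 3 * B * C * (1 + a)" by simp
    have zB: "Im z + cmod z \<le> 2 * B" using B(2) abs_Im_le_cmod[of z] by linarith
    have "u\<^sup>2 / (real N)\<^sup>2 * cmod (Err k X) \<le> u\<^sup>2 / (real N)\<^sup>2 * ((real N)\<^sup>2 * (Im z + cmod z) *
       (\<epsilon> * cmod (g X) * a ^ (2 * k + 1) + 2 * real (2 * k + 1) * \<epsilon>\<^sup>2 * cmod (g X) * cmod (P' X) * a ^ (2 * k)))"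
      unfolding \<epsilon>_def a_def by (intro mult_left_mono Err_bound) auto
    also have "\<dots> = u\<^sup>2 * (Im z + cmod z) *
       (\<epsilon> * cmod (g X) * a ^ (2 * k + 1) + 2 * real (2 * k + 1) * \<epsilon>\<^sup>2 * (cmod (g X) * cmod (P' X)) * a ^ (2 * k))"
      using N_pos by (simp add: mult.assoc)
    also have "\<dots> \<le> u\<^sup>2 * (2 * B) *
       (\<epsilon> * (C * (1 + a)) * a ^ (2 * k + 1) + 2 * real (2 * k + 1) * \<epsilon>\<^sup>2 * (3 * B * C * (1 + a)) * a ^ (2 * k))"
    proof (rule mult_mono[OF _ add_mono])
      show "u\<^sup>2 * (Im z + cmod z) \<le> u\<^sup>2 * (2 * B)" using zB by (intro mult_left_mono) auto
      show "\<epsilon> * cmod (g X) * a ^ (2 * k + 1) \<le> \<epsilon> * (C * (1 + a)) * a ^ (2 * k + 1)"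
        using \<epsilon> a0 by (intro mult_right_mono mult_left_mono g1) auto
      show "2 * real (2 * k + 1) * \<epsilon>\<^sup>2 * (cmod (g X) * cmod (P' X)) * a ^ (2 * k)
        \<le> 2 * real (2 * k + 1) * \<epsilon>\<^sup>2 * (3 * B * C * (1 + a)) * a ^ (2 * k)"
        using a0 by (intro mult_right_mono mult_left_mono gP) auto
    qed (use \<epsilon> a0 B0 in auto)
    also have "\<dots> = 2 * u\<^sup>2 * B * C * (\<epsilon> * (1 + a) * a ^ (2 * k + 1) + 6 * real (2 * k + 1) * B * (\<epsilon>\<^sup>2 * (1 + a) * a ^ (2 * k)))"
      by (simp add: algebra_simps)
    also have "\<dots> \<le> 2 * u\<^sup>2 * B * C * ((1 + 6 * real (2 * k + 1) * B) * (\<epsilon> * (1 + a) * a ^ (2 * k + 1))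
       + (1 + 6 * real (2 * k + 1) * B) * (\<epsilon>\<^sup>2 * (1 + a) * a ^ (2 * k)))"
    proof (intro mult_left_mono add_mono)
      have "1 * (\<epsilon> * (1 + a) * a ^ (2 * k + 1)) \<le> (1 + 6 * real (2 * k + 1) * B) * (\<epsilon> * (1 + a) * a ^ (2 * k + 1))"
        using \<epsilon> a0 B0 by (intro mult_right_mono) auto
      then show "\<epsilon> * (1 + a) * a ^ (2 * k + 1) \<le> (1 + 6 * real (2 * k + 1) * B) * (\<epsilon> * (1 + a) * a ^ (2 * k + 1))"
        by simp
      show "6 * real (2 * k + 1) * B * (\<epsilon>\<^sup>2 * (1 + a) * a ^ (2 * k)) \<le> (1 + 6 * real (2 * k + 1) * B) * (\<epsilon>\<^sup>2 * (1 + a) * a ^ (2 * k))"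
        using \<epsilon> a0 B0 by (intro mult_right_mono) auto
    qed (use B0 C0 in auto)
    also have "\<dots> = K * (\<epsilon> * (1 + a) * a ^ (2 * k + 1) + \<epsilon>\<^sup>2 * (1 + a) * a ^ (2 * k))"
      unfolding K by (simp only: distrib_left[symmetric] mult.assoc)
    also have "\<dots> \<le> a ^ (2 * k + 2) / 2 + D"
      unfolding D_def by (rule young_absorb[OF a0 \<epsilon>(1) K0 L(1) \<epsilon>(2)])
    finally show ?thesis by (simp add: a_def)
  qed
  let ?J = "\<integral>X. cmod (P X) ^ (2 * k + 2) \<partial>\<Omega>"
  have J0: "0 \<le> ?J" by (intro integral_nonneg_AE) auto
  have "?J = cmod (complex_of_real ?J)" using J0 by simp
  also have "complex_of_real ?J = u\<^sup>2 / (real N)\<^sup>2 * (\<integral>X. Err k X \<partial>\<Omega>)"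
    using P_moment_identity(2)[of k] N_pos by (simp add: field_simps)
  also have "cmod \<dots> = u\<^sup>2 / (real N)\<^sup>2 * cmod (\<integral>X. Err k X \<partial>\<Omega>)"
    by (simp add: norm_mult norm_divide norm_power)
  also have "\<dots> \<le> u\<^sup>2 / (real N)\<^sup>2 * (\<integral>X. cmod (Err k X) \<partial>\<Omega>)"
    by (intro mult_left_mono integral_norm_bound) auto
  also have "\<dots> = (\<integral>X. u\<^sup>2 / (real N)\<^sup>2 * cmod (Err k X) \<partial>\<Omega>)"
    by (rule integral_mult_right_zero[symmetric])
  also have "\<dots> \<le> (\<integral>X. cmod (P X) ^ (2 * k + 2) / 2 + D \<partial>\<Omega>)"
    using P_moment_identity(1)[of k] P_power_integrable[of "2 * k + 2"]
    by (intro integral_mono key) auto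
  also have "\<dots> = ?J / 2 + D"
    using P_power_integrable[of "2 * k + 2"] by (subst Bochner_Integration.integral_add) (auto simp: prob_space)
  \<comment> \<open>Moving half of the moment to the left doubles \<open>D\<close>, hence the factor
    4 where \<open>young_absorb\<close> has 2.\<close>
  finally show ?thesis unfolding D_def \<epsilon>_def by simp
qed

end

section \<open>Almost sure convergence and the limiting quadratic\<close>

lemma (in prob_space) AE_tendsto_0_of_summable_expectation:
  fixes Y :: "nat \<Rightarrow> 'a \<Rightarrow> real"
  assumes int: "\<And>n. n \<ge> j \<Longrightarrow> integrable M (Y n)" and nn: "\<And>n \<omega>. 0 \<le> Y n \<omega>"
    and le: "\<And>n. n \<ge> j \<Longrightarrow> expectation (Y n) \<le> d n" and d: "summable d"
  shows "AE \<omega> in M. (\<lambda>n. Y n \<omega>) \<longlonglongrightarrow> 0"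
proof -
  have m: "(\<lambda>\<omega>. ennreal (Y (n + j) \<omega>)) \<in> borel_measurable M" for n
    using int[of "n + j"] by auto
  have d': "summable (\<lambda>n. d (n + j))" using d by (simp add: summable_iff_shift)
  have d0: "0 \<le> d (n + j)" for n
  proof -
    have "0 \<le> expectation (Y (n + j))" by (rule integral_nonneg_AE) (use nn in auto)
    then show ?thesis using le[of "n + j"] by simp
  qed
  \<comment> \<open>By Tonelli the series has finite expectation, so it converges almost everywhere
    and its terms tend to 0. The shift by \<open>j\<close> skips the indices for which no bound is
    available.\<close>
  have "(\<integral>\<^sup>+\<omega>. (\<Sum>n. ennreal (Y (n + j) \<omega>)) \<partial>M) = (\<Sum>n. \<integral>\<^sup>+\<omega>. ennreal (Y (n + j) \<omega>) \<partial>M)"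
    by (rule nn_integral_suminf[OF m])
  also have "\<dots> \<le> (\<Sum>n. ennreal (d (n + j)))"
  proof (intro suminf_le allI)
    fix n
    have "(\<integral>\<^sup>+\<omega>. ennreal (Y (n + j) \<omega>) \<partial>M) = ennreal (expectation (Y (n + j)))"
      using int[of "n + j"] nn by (intro nn_integral_eq_integral) auto
    also have "\<dots> \<le> ennreal (d (n + j))" using le[of "n + j"] by (intro ennreal_leI) auto
    finally show "(\<integral>\<^sup>+\<omega>. ennreal (Y (n + j) \<omega>) \<partial>M) \<le> ennreal (d (n + j))" .
  qed auto
  also have "\<dots> < \<infinity>"
    using suminf_ennreal2[OF d0 d'] by simp
  finally have "(\<integral>\<^sup>+\<omega>. (\<Sum>n. ennreal (Y (n + j) \<omega>)) \<partial>M) \<noteq> \<infinity>" by simp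
  then have "AE \<omega> in M. (\<Sum>n. ennreal (Y (n + j) \<omega>)) \<noteq> \<infinity>"
    using m by (intro nn_integral_PInf_AE) auto
  then show ?thesis
  proof eventually_elim
    case (elim \<omega>)
    then have "summable (\<lambda>n. Y (n + j) \<omega>)"
      using nn by (intro summable_suminf_not_top) auto
    then have "(\<lambda>n. Y (n + j) \<omega>) \<longlonglongrightarrow> 0" by (rule summable_LIMSEQ_zero)
    then show ?case by (rule LIMSEQ_offset)
  qed
qed

text \<open>Of the two conjugate roots of the limiting quadratic only one lies in the upper half plane, while
  a \<open>g\<close> with \<open>Im g \<ge> 0\<close> stays at distance \<open>s\<close> from the other.\<close>
lemma Im_root_tendsto:
  fixes g p \<beta> z :: "nat \<Rightarrow> complex" and u c l s :: real
  assumes u: "u > 0" and l: "l > 0" and pos: "(l - u\<^sup>2 * (1 + c))\<^sup>2 < 4 * c * u ^ 4"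
    and s: "s = sqrt (4 * c * u ^ 4 - (l - u\<^sup>2 * (1 + c))\<^sup>2) / (2 * l * u\<^sup>2)"
    and Im: "eventually (\<lambda>n. 0 \<le> Im (g n)) sequentially"
    and bnd: "eventually (\<lambda>n. cmod (g n) \<le> K) sequentially"
    and eq: "eventually (\<lambda>n. p n = 1 + \<beta> n * g n + u\<^sup>2 * z n * (g n)\<^sup>2) sequentially"
    and p: "p \<longlonglongrightarrow> 0" and \<beta>: "\<beta> \<longlonglongrightarrow> complex_of_real (l + u\<^sup>2 * (1 - c))" and z: "z \<longlonglongrightarrow> complex_of_real l"
  shows "(\<lambda>n. Im (g n)) \<longlonglongrightarrow> s"
proof -
  define b where "b = l + u\<^sup>2 * (1 - c)"
  define A where "A = u\<^sup>2 * l"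
  have A: "A > 0" using u l by (simp add: A_def)
  have s0: "s > 0" unfolding s using u l pos by simp
  \<comment> \<open>\<open>r\<close> is the root of 1 + b w + A w^2 in the upper half plane: the
    radicand in \<open>s\<close> equals 4 A - b^2, minus the discriminant of this quadratic.\<close>
  define r where "r = Complex (- b / (2 * A)) s"
  have "(2 * l * u\<^sup>2 * s)\<^sup>2 = 4 * c * u ^ 4 - (l - u\<^sup>2 * (1 + c))\<^sup>2"
    unfolding s using u l pos by simp
  then have "4 * A\<^sup>2 * s\<^sup>2 = 4 * c * u ^ 4 - (l - u\<^sup>2 * (1 + c))\<^sup>2"
    by (simp add: A_def power_mult_distrib mult_ac)
  also have "\<dots> = 4 * A - b\<^sup>2"
    by (simp add: A_def b_def power2_eq_square power4_eq_xxxx algebra_simps)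
  finally have id: "4 * A\<^sup>2 * s\<^sup>2 + b\<^sup>2 = 4 * A" by simp
  have factor: "1 + b * w + A * w\<^sup>2 = A * (w - r) * (w - cnj r)" for w :: complex
  proof -
    have r1: "r + cnj r = complex_of_real (- b / A)" using A by (simp add: r_def complex_eq_iff)
    have "A * ((b / (2 * A))\<^sup>2 + s\<^sup>2) = 1"
    proof -
      have "4 * A * (A * ((b / (2 * A))\<^sup>2 + s\<^sup>2)) = 4 * A\<^sup>2 * s\<^sup>2 + b\<^sup>2"
        using A by (simp add: power2_eq_square field_simps)
      then have "4 * A * (A * ((b / (2 * A))\<^sup>2 + s\<^sup>2)) = 4 * A * 1" using id by simp
      then show ?thesis using A mult_cancel_left[of "4 * A" "A * ((b / (2 * A))\<^sup>2 + s\<^sup>2)" 1] by linarith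
    qed
    then have r2: "A * (r * cnj r) = 1"
      unfolding complex_norm_square[symmetric] of_real_mult[symmetric]
      by (simp add: r_def cmod_power2 power_divide power_mult_distrib)
    have "A * (w - r) * (w - cnj r) = A * w\<^sup>2 - A * w * (r + cnj r) + A * (r * cnj r)"
      by (simp add: power2_eq_square algebra_simps)
    also have "\<dots> = 1 + b * w + A * w\<^sup>2" unfolding r1 r2 using A by simp
    finally show ?thesis by simp
  qed
  \<comment> \<open>The limiting polynomial at \<open>g n\<close>. It differs from
    \<open>p n\<close> only in its coefficients, and the bound on \<open>g\<close> makes the
    difference tend to 0.\<close>
  define q where "q n = 1 + b * g n + A * (g n)\<^sup>2" for n
  have "eventually (\<lambda>n. norm (q n) \<le> cmod (p n) + cmod (\<beta> n - b) * \<bar>K\<bar> + u\<^sup>2 * cmod (z n - l) * \<bar>K\<bar>\<^sup>2) sequentially"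
    using bnd eq
  proof eventually_elim
    case (elim n)
    have K: "cmod (g n) \<le> \<bar>K\<bar>" using elim(1) by linarith
    have "q n = p n - (\<beta> n - b) * g n - u\<^sup>2 * (z n - l) * (g n)\<^sup>2"
      unfolding elim(2) q_def A_def by (simp add: algebra_simps)
    then have "cmod (q n) \<le> cmod (p n) + cmod ((\<beta> n - b) * g n) + cmod (u\<^sup>2 * (z n - l) * (g n)\<^sup>2)"
      by (simp only: order_trans[OF norm_triangle_ineq4 add_right_mono[OF norm_triangle_ineq4]])
    also have "\<dots> = cmod (p n) + cmod (\<beta> n - b) * cmod (g n) + u\<^sup>2 * cmod (z n - l) * (cmod (g n))\<^sup>2"
      by (simp add: norm_mult norm_power)
    also have "\<dots> \<le> cmod (p n) + cmod (\<beta> n - b) * \<bar>K\<bar> + u\<^sup>2 * cmod (z n - l) * \<bar>K\<bar>\<^sup>2"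
      using K by (intro add_mono mult_left_mono power_mono) auto
    finally show ?case .
  qed
  moreover have "(\<lambda>n. cmod (p n) + cmod (\<beta> n - b) * \<bar>K\<bar> + u\<^sup>2 * cmod (z n - l) * \<bar>K\<bar>\<^sup>2) \<longlonglongrightarrow> 0"
  proof -
    have "(\<lambda>n. \<beta> n - b) \<longlonglongrightarrow> 0" and "(\<lambda>n. z n - l) \<longlonglongrightarrow> 0"
      using LIM_zero[OF \<beta>] LIM_zero[OF z] by (simp_all add: b_def)
    then have e: "(\<lambda>n. cmod (\<beta> n - b)) \<longlonglongrightarrow> 0" "(\<lambda>n. cmod (z n - l)) \<longlonglongrightarrow> 0"
      by (simp_all add: tendsto_norm_zero)
    show ?thesis
      using tendsto_add[OF tendsto_add[OF tendsto_norm_zero[OF p] tendsto_mult_left_zero[OF e(1), of "\<bar>K\<bar>"]]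
          tendsto_mult_left_zero[OF tendsto_mult_right_zero[OF e(2), of "u\<^sup>2"], of "\<bar>K\<bar>\<^sup>2"]]
      by simp
  qed
  ultimately have q: "q \<longlonglongrightarrow> 0" by (rule Lim_null_comparison)
  have "eventually (\<lambda>n. norm (Im (g n) - s) \<le> cmod (q n) / (A * s)) sequentially"
    using Im
  proof eventually_elim
    case (elim n)
    have "s \<le> \<bar>Im (g n - cnj r)\<bar>" using elim s0 by (simp add: r_def)
    then have 1: "s \<le> cmod (g n - cnj r)" using abs_Im_le_cmod[of "g n - cnj r"] by linarith
    have "\<bar>Im (g n) - s\<bar> \<le> cmod (g n - r)" using abs_Im_le_cmod[of "g n - r"] by (simp add: r_def)
    then have "A * \<bar>Im (g n) - s\<bar> * s \<le> A * cmod (g n - r) * cmod (g n - cnj r)"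
      using A s0 1 by (intro mult_mono mult_left_mono) auto
    also have "\<dots> = cmod (q n)" unfolding q_def factor using A by (simp add: norm_mult)
    finally show ?case using A s0 by (simp add: field_simps)
  qed
  moreover have "(\<lambda>n. cmod (q n) / (A * s)) \<longlonglongrightarrow> 0"
    using tendsto_divide[OF tendsto_norm[OF q] tendsto_const[of "A * s"]] A s0 by simp
  ultimately have "(\<lambda>n. Im (g n) - s) \<longlonglongrightarrow> 0" by (rule Lim_null_comparison)
  then show ?thesis by (simp add: LIM_zero_iff)
qed

text \<open>The resolvent sees only the entries with \<open>\<mu> < m\<close> and
  \<open>x < N\<close>. Restricting the array makes it a point of the product space, whose elements
  are extensional.\<close>

lemma (in resolvent) R_stat_eq:
  assumes "z = Complex l (N powr - \<alpha>)" and I: "{..<m} \<times> {..<N} \<subseteq> I"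
  shows "R_stat \<xi> m N \<alpha> l = Im (g (restrict (\<lambda>(\<mu>, x). \<xi> \<mu> x) I))"
proof -
  let ?X = "restrict (\<lambda>(\<mu>, x). \<xi> \<mu> x) I"
  have "?X (\<mu>, x) = \<xi> \<mu> x" if "\<mu> < m" "x < N" for \<mu> x
    using that I by auto
  then have "H_mat (curry ?X) m N = H_mat \<xi> m N"
    unfolding H_mat_def by (intro cong_mat refl) (auto intro!: sum.cong simp: curry_def)
  then have "G_mat (curry ?X) m N z = G_mat \<xi> m N z" by (simp add: G_mat_def)
  then have "mat_tr (G_mat \<xi> m N z) = N * g ?X"
    using G_mat_inverse(3)[of ?X] N_pos by (auto simp: mat_tr_def g_def G_def)
  then show ?thesis unfolding R_stat_def assms(1)[symmetric] using N_pos by simp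
qed

text \<open>Transfers \<open>moment_bound\<close> to the given probability space through the joint
  law of finitely many entries. The constants remain parameters, so that one choice serves all large
  N.\<close>

lemma gaussian_array_moment_bound:
  fixes X :: "nat \<times> nat \<Rightarrow> 'a \<Rightarrow> real"
  assumes "gaussian_family M X u" and "gaussian_resolvent N z u"
    and b: "0 < b" "b \<le> u\<^sup>2 * cmod z"
    and B: "cmod (gaussian_resolvent.\<beta> m N z u) \<le> B" "cmod z \<le> B" "u\<^sup>2 * cmod z \<le> B"
    and C: "C = 1 + (2 / b + (B / b)\<^sup>2)" and K: "K = 2 * u\<^sup>2 * B * C * (1 + 6 * real (2 * k + 1) * B)"
    and L: "L = 8 * K + 1" "L \<le> N * Im z"
  defines "Y \<equiv> \<lambda>\<omega>. cmod (gaussian_resolvent.P m N z u (restrict (\<lambda>i. X i \<omega>) ({..<m} \<times> {..<N}))) ^ (2 * k + 2)"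
  shows "integrable M Y"
    and "integral\<^sup>L M Y \<le> 4 * K * (L ^ (2 * k + 1) + L ^ (2 * k)) * (1 / (N * Im z)) ^ (2 * k + 2)"
proof -
  interpret F: gaussian_family M X u by fact
  interpret R: gaussian_resolvent m N z u by fact
  have distr: "distr M R.\<Omega> (\<lambda>\<omega>. restrict (\<lambda>i. X i \<omega>) R.I) = R.\<Omega>"
    by (rule F.distr_PiM_gauss[OF R.finite_I])
  have m: "(\<lambda>\<omega>. restrict (\<lambda>i. X i \<omega>) R.I) \<in> measurable M R.\<Omega>"
    by (intro measurable_restrict) auto
  have int: "integrable R.\<Omega> (\<lambda>x. cmod (R.P x) ^ (2 * k + 2))"
    by (rule R.P_power_integrable)
  have Y: "Y = (\<lambda>\<omega>. cmod (R.P (restrict (\<lambda>i. X i \<omega>) R.I)) ^ (2 * k + 2))"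
    unfolding Y_def R.I_def ..
  have "integrable (distr M R.\<Omega> (\<lambda>\<omega>. restrict (\<lambda>i. X i \<omega>) R.I)) (\<lambda>x. cmod (R.P x) ^ (2 * k + 2))"
    using int unfolding distr .
  then show "integrable M Y"
    unfolding Y by (rule integrable_distr[OF m])
  have "integral\<^sup>L M Y = (\<integral>x. cmod (R.P x) ^ (2 * k + 2) \<partial>distr M R.\<Omega> (\<lambda>\<omega>. restrict (\<lambda>i. X i \<omega>) R.I))"
    unfolding Y by (rule integral_distr[OF m borel_measurable_integrable[OF int], symmetric])
  also have "\<dots> \<le> 4 * K * (L ^ (2 * k + 1) + L ^ (2 * k)) * (1 / (N * Im z)) ^ (2 * k + 2)"
    unfolding distr by (rule R.moment_bound[OF b B C K L])
  finally show "integral\<^sup>L M Y \<le> 4 * K * (L ^ (2 * k + 1) + L ^ (2 * k)) * (1 / (N * Im z)) ^ (2 * k + 2)" .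
qed

theorem theorem1:
  fixes M :: "'a measure"
    and \<xi> :: "nat \<Rightarrow> nat \<Rightarrow> 'a \<Rightarrow> real"
    and u c \<alpha> l :: real
    and m :: "nat \<Rightarrow> nat"
  assumes "prob_space M"
    and "u > 0" and "c > 0"
    and "jointly_gaussian M UNIV (\<lambda>(\<mu>, x). \<xi> \<mu> x)"
    and "\<And>\<mu> x. integral\<^sup>L M (\<xi> \<mu> x) = 0"
    and "\<And>\<mu> \<nu> x y. integral\<^sup>L M (\<lambda>\<omega>. \<xi> \<mu> x \<omega> * \<xi> \<nu> y \<omega>)
           = u\<^sup>2 * (if x = y then 1 else 0) * (if \<mu> = \<nu> then 1 else 0)"
    and "(\<lambda>N. real (m N) / real N) \<longlonglongrightarrow> c"
    and "0 < \<alpha>" and "\<alpha> < 1"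
    and "l \<in> \<Lambda>_set c u"
  shows "(AE \<omega> in M. (\<lambda>N. R_stat (\<lambda>\<mu> x. \<xi> \<mu> x \<omega>) (m N) N \<alpha> l) \<longlonglongrightarrow> pi * \<rho>_MP u c l) \<and>
    pi * \<rho>_MP u c l = 1 / (2 * l * u\<^sup>2) * sqrt (4 * c * u ^ 4 - (l - u\<^sup>2 * (1 + c))\<^sup>2)"
proof -
  define X where "X = (\<lambda>(\<mu>, x). \<xi> \<mu> x)"
  interpret prob_space M by fact
  have GF: "gaussian_family M X u"
  proof
    show "expectation (X i) = 0" for i using assms(5) by (cases i) (simp add: X_def)
    show "expectation (\<lambda>\<omega>. X i \<omega> * X j \<omega>) = (if i = j then u\<^sup>2 else 0)" for i j
      using assms(6) by (cases i; cases j) (auto simp: X_def)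
  qed (use assms X_def in auto)
  have u: "u > 0" "u\<^sup>2 > 0" using assms(2) by auto
  have edges: "l > u\<^sup>2 * (1 - sqrt c)\<^sup>2" "l < u\<^sup>2 * (1 + sqrt c)\<^sup>2"
    using assms(10) by (auto simp: \<Lambda>_set_def)
  have l: "l > 0" using edges(1) by (rule le_less_trans[rotated]) simp
  have pos: "(l - u\<^sup>2 * (1 + c))\<^sup>2 < 4 * c * u ^ 4"
  proof -
    \<comment> \<open>The edges are u^2 (1 + c) plus or minus 2 u^2 sqrt c, so lying strictly
      between them amounts to positivity of the radicand.\<close>
    have e: "u\<^sup>2 * (1 - sqrt c)\<^sup>2 = u\<^sup>2 * (1 + c) - 2 * u\<^sup>2 * sqrt c"
      "u\<^sup>2 * (1 + sqrt c)\<^sup>2 = u\<^sup>2 * (1 + c) + 2 * u\<^sup>2 * sqrt c"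
      using assms(3) by (simp_all add: power2_sum power2_diff algebra_simps)
    then have "\<bar>l - u\<^sup>2 * (1 + c)\<bar> < 2 * u\<^sup>2 * sqrt c" using edges by linarith
    then have "\<bar>l - u\<^sup>2 * (1 + c)\<bar>\<^sup>2 < (2 * u\<^sup>2 * sqrt c)\<^sup>2"
      by (intro power_strict_mono) auto
    then show ?thesis using assms(3) by (simp add: power_mult_distrib mult_ac)
  qed
  define s where "s = sqrt (4 * c * u ^ 4 - (l - u\<^sup>2 * (1 + c))\<^sup>2) / (2 * l * u\<^sup>2)"
  have \<rho>: "pi * \<rho>_MP u c l = s" unfolding \<rho>_MP_def s_def by (simp add: field_simps)

  define z where "z N = Complex l (real N powr - \<alpha>)" for N
  have GR: "gaussian_resolvent N (z N) u" if "N > 0" for N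
    using that u by unfold_locales (auto simp: z_def)
  define \<beta> where "\<beta> N = gaussian_resolvent.\<beta> (m N) N (z N) u" for N
  have \<beta>_eq: "\<beta> N = z N + u\<^sup>2 * (1 - real (m N) / N)" if "N > 0" for N
    using gaussian_resolvent.\<beta>_def[OF GR[OF that], of "m N"] by (simp add: \<beta>_def)
  have powr_lim: "(\<lambda>N. real N powr - \<alpha>) \<longlonglongrightarrow> 0"
    using assms(8) by real_asymp
  have z_lim: "z \<longlonglongrightarrow> complex_of_real l"
    unfolding tendsto_complex_iff using powr_lim by (simp add: z_def)
  have \<beta>_lim: "\<beta> \<longlonglongrightarrow> complex_of_real (l + u\<^sup>2 * (1 - c))"
  proof -
    have "(\<lambda>N. z N + complex_of_real (u\<^sup>2 * (1 - real (m N) / N))) \<longlonglongrightarrow> complex_of_real l + complex_of_real (u\<^sup>2 * (1 - c))"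
      by (intro tendsto_intros z_lim assms(7))
    then have "(\<lambda>N. z N + complex_of_real (u\<^sup>2 * (1 - real (m N) / N))) \<longlonglongrightarrow> complex_of_real (l + u\<^sup>2 * (1 - c))"
      by simp
    moreover have "eventually (\<lambda>N. z N + complex_of_real (u\<^sup>2 * (1 - real (m N) / N)) = \<beta> N) sequentially"
      using eventually_gt_at_top[of 0] by eventually_elim (simp add: \<beta>_eq)
    ultimately show ?thesis by (rule Lim_transform_eventually)
  qed

  \<comment> \<open>This \<open>k\<close> gives (2k + 2)(1 - \<alpha>) \<ge> 2, so the moments are
    bounded by a multiple of the summable N^(-2).\<close>
  define k where "k = nat \<lceil>1 / (1 - \<alpha>)\<rceil>"
  \<comment> \<open>The constants have to be uniform in N. \<open>b\<close> works because
    \<open>Re (z N) = l\<close>. In \<open>B\<close> the first summand covers |z| and u^2 |z|, as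
    |z| \<le> l + 1; the others leave room for \<open>\<beta> N\<close> near its limit.\<close>
  define b where "b = u\<^sup>2 * l"
  define B where "B = (l + 1) * (1 + u\<^sup>2) + cmod (complex_of_real (l + u\<^sup>2 * (1 - c))) + 1"
  define C where "C = 1 + (2 / b + (B / b)\<^sup>2)"
  define K where "K = 2 * u\<^sup>2 * B * C * (1 + 6 * real (2 * k + 1) * B)"
  define L where "L = 8 * K + 1"
  define D where "D = 4 * K * (L ^ (2 * k + 1) + L ^ (2 * k))"
  have b0: "b > 0" using u l by (simp add: b_def)
  have B0: "B > 0" using l by (simp add: B_def add_pos_nonneg add_nonneg_pos)
  have C0: "C > 0" using b0 B0 by (simp add: C_def add_pos_nonneg)
  have K0: "K > 0" unfolding K_def using u B0 C0 by (simp add: add_pos_nonneg)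
  have D0: "D > 0" unfolding D_def L_def using K0 by (simp add: add_pos_nonneg)

  have "eventually (\<lambda>N. L \<le> real N * real N powr - \<alpha>) sequentially"
  proof -
    have "filterlim (\<lambda>N. real N * real N powr - \<alpha>) at_top sequentially"
      using assms(9) by real_asymp
    then show ?thesis by (simp add: filterlim_at_top)
  qed
  moreover have "eventually (\<lambda>N. cmod (\<beta> N) \<le> B) sequentially"
  proof -
    have "cmod (complex_of_real (l + u\<^sup>2 * (1 - c))) < B"
      using l by (simp add: B_def add_pos_nonneg)
    from order_tendstoD(2)[OF tendsto_norm[OF \<beta>_lim] this] show ?thesis
      by eventually_elim simp
  qed
  ultimately have "eventually (\<lambda>N. N > 0 \<and> L \<le> real N * real N powr - \<alpha> \<and> cmod (\<beta> N) \<le> B) sequentially"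
    using eventually_gt_at_top[of 0] by eventually_elim auto
  then obtain N0 where N0: "\<And>N. N \<ge> N0 \<Longrightarrow> N > 0" "\<And>N. N \<ge> N0 \<Longrightarrow> L \<le> real N * real N powr - \<alpha>"
    "\<And>N. N \<ge> N0 \<Longrightarrow> cmod (\<beta> N) \<le> B"
    unfolding eventually_sequentially by blast
  have z_bounds: "b \<le> u\<^sup>2 * cmod (z N)" "cmod (z N) \<le> B" "u\<^sup>2 * cmod (z N) \<le> B" if "N \<ge> N0" for N
  proof -
    have "l \<le> cmod (z N)" using abs_Re_le_cmod[of "z N"] by (simp add: z_def)
    then show "b \<le> u\<^sup>2 * cmod (z N)" unfolding b_def by (intro mult_left_mono) auto
    have "real N powr - \<alpha> \<le> real N powr 0"
      using N0(1)[OF that] assms(8) by (intro powr_mono) auto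
    then have 1: "cmod (z N) \<le> l + 1"
      using cmod_le[of "z N"] l N0(1)[OF that] by (simp add: z_def)
    have B1: "(l + 1) * (1 + u\<^sup>2) \<le> B" by (simp add: B_def)
    have "cmod (z N) \<le> (l + 1) * 1" using 1 by simp
    also have "\<dots> \<le> (l + 1) * (1 + u\<^sup>2)" using l by (intro mult_left_mono) auto
    finally show "cmod (z N) \<le> B" using B1 by linarith
    have "u\<^sup>2 * cmod (z N) \<le> u\<^sup>2 * (l + 1)" using 1 by (intro mult_left_mono) auto
    also have "\<dots> \<le> (l + 1) * (1 + u\<^sup>2)" using l by (simp add: algebra_simps)
    finally show "u\<^sup>2 * cmod (z N) \<le> B" using B1 by linarith
  qed

  define Y where "Y N \<omega> = restrict (\<lambda>i. X i \<omega>) ({..<m N} \<times> {..<N})" for N \<omega>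
  define p where "p N \<omega> = gaussian_resolvent.P (m N) N (z N) u (Y N \<omega>)" for N \<omega>
  define g where "g N \<omega> = resolvent.g (m N) N (z N) (Y N \<omega>)" for N \<omega>
  have mom: "integrable M (\<lambda>\<omega>. cmod (p N \<omega>) ^ (2 * k + 2))"
    "expectation (\<lambda>\<omega>. cmod (p N \<omega>) ^ (2 * k + 2)) \<le> D * real N powr - 2" if N: "N \<ge> N0" for N
  proof -
    have Im: "Im (z N) = real N powr - \<alpha>" by (simp add: z_def)
    note bnd = gaussian_array_moment_bound[OF GF GR[OF N0(1)[OF N]] b0 z_bounds(1)[OF N]
        N0(3)[OF N, unfolded \<beta>_def] z_bounds(2,3)[OF N] C_def K_def L_def, unfolded Im, OF N0(2)[OF N]]
    show "integrable M (\<lambda>\<omega>. cmod (p N \<omega>) ^ (2 * k + 2))"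
      using bnd(1) by (simp add: p_def Y_def)
    have "expectation (\<lambda>\<omega>. cmod (p N \<omega>) ^ (2 * k + 2)) \<le> D * (1 / (real N * real N powr - \<alpha>)) ^ (2 * k + 2)"
      using bnd(2) unfolding D_def p_def Y_def .
    also have "(1 / (real N * real N powr - \<alpha>)) ^ (2 * k + 2) = real N powr (real (2 * k + 2) * (\<alpha> - 1))"
    proof -
      have "1 / (real N * real N powr - \<alpha>) = real N powr (\<alpha> - 1)"
        using N0(1)[OF N] by (simp add: powr_diff powr_minus field_simps)
      then show ?thesis using N0(1)[OF N] by (simp only: powr_power)
    qed
    also have "\<dots> \<le> real N powr - 2"
    proof (intro powr_mono)
      have "1 / (1 - \<alpha>) \<le> real k" unfolding k_def by linarith
      then have "1 \<le> (1 - \<alpha>) * (real k + 1)"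
        using assms(9) by (simp add: field_simps)
      then show "real (2 * k + 2) * (\<alpha> - 1) \<le> - 2" by (simp add: algebra_simps)
      show "1 \<le> real N" using N0(1)[OF N] by simp
    qed
    finally show "expectation (\<lambda>\<omega>. cmod (p N \<omega>) ^ (2 * k + 2)) \<le> D * real N powr - 2"
      using D0 by simp
  qed
  have "AE \<omega> in M. (\<lambda>N. cmod (p N \<omega>) ^ (2 * k + 2)) \<longlonglongrightarrow> 0"
  proof (rule AE_tendsto_0_of_summable_expectation[where j = N0])
    show "summable (\<lambda>N. D * real N powr - 2)"
      by (intro summable_mult) (simp add: summable_real_powr_iff)
  qed (use mom in auto)
  then have "AE \<omega> in M. (\<lambda>N. R_stat (\<lambda>\<mu> x. \<xi> \<mu> x \<omega>) (m N) N \<alpha> l) \<longlonglongrightarrow> s"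
  proof eventually_elim
    case (elim \<omega>)
    then have "(\<lambda>N. cmod (p N \<omega>)) \<longlonglongrightarrow> 0" by (subst (asm) power_tendsto_0_iff) auto
    then have p: "(\<lambda>N. p N \<omega>) \<longlonglongrightarrow> 0" by (rule tendsto_norm_zero_cancel)
    have "(\<lambda>N. Im (g N \<omega>)) \<longlonglongrightarrow> s"
    proof (rule Im_root_tendsto[OF u(1) l pos s_def _ _ _ p \<beta>_lim z_lim])
      show "eventually (\<lambda>N. 0 \<le> Im (g N \<omega>)) sequentially"
        using eventually_ge_at_top[of N0]
      proof eventually_elim
        case (elim N)
        interpret R: gaussian_resolvent "m N" N "z N" u by (rule GR[OF N0(1)[OF elim]])
        show ?case unfolding g_def by (rule R.Im_g_nonneg)
      qed
      show "eventually (\<lambda>N. p N \<omega> = 1 + \<beta> N * g N \<omega> + u\<^sup>2 * z N * (g N \<omega>)\<^sup>2) sequentially"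
        using eventually_ge_at_top[of N0]
      proof eventually_elim
        case (elim N)
        interpret R: gaussian_resolvent "m N" N "z N" u by (rule GR[OF N0(1)[OF elim]])
        show ?case unfolding g_def p_def \<beta>_def R.P_def by simp
      qed
      \<comment> \<open>Convergence of \<open>p\<close> supplies the bound on \<open>g\<close> that
        \<open>Im_root_tendsto\<close> asks for: once \<open>cmod (p N \<omega>) < 1\<close>, the
        last factor in \<open>g_square_bound\<close> is at most 2.\<close>
      have "eventually (\<lambda>N. cmod (p N \<omega>) < 1) sequentially"
        using order_tendstoD(2)[OF tendsto_norm_zero[OF p], of 1] by simp
      then show "eventually (\<lambda>N. cmod (g N \<omega>) \<le> sqrt ((2 / b + (B / b)\<^sup>2) * 2)) sequentially"
        using eventually_ge_at_top[of N0]
      proof eventually_elim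
        case (elim N)
        interpret R: gaussian_resolvent "m N" N "z N" u by (rule GR[OF N0(1)[OF elim(2)]])
        have "(cmod (g N \<omega>))\<^sup>2 \<le> (2 / b + (B / b)\<^sup>2) * (1 + cmod (p N \<omega>))"
          unfolding g_def p_def
          by (rule R.g_square_bound[OF b0 z_bounds(1)[OF elim(2)] N0(3)[OF elim(2), unfolded \<beta>_def]])
        also have "\<dots> \<le> (2 / b + (B / b)\<^sup>2) * 2"
          using elim(1) b0 by (intro mult_left_mono) auto
        finally show ?case by (rule real_le_rsqrt)
      qed
    qed
    moreover have "eventually (\<lambda>N. Im (g N \<omega>) = R_stat (\<lambda>\<mu> x. \<xi> \<mu> x \<omega>) (m N) N \<alpha> l) sequentially"
      using eventually_ge_at_top[of N0]
    proof eventually_elim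
      case (elim N)
      interpret R: gaussian_resolvent "m N" N "z N" u by (rule GR[OF N0(1)[OF elim]])
      have "Y N \<omega> = restrict (\<lambda>(\<mu>, x). \<xi> \<mu> x \<omega>) ({..<m N} \<times> {..<N})"
        unfolding Y_def X_def by (intro restrict_ext) auto
      then show ?case
        unfolding g_def by (subst R.R_stat_eq[OF z_def order_refl]) simp
    qed
    ultimately show ?case by (rule Lim_transform_eventually)
  qed
  then show ?thesis unfolding \<rho> by (simp add: s_def)
qed

end
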